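(* Let $\mathcal{D}$ be an arbitrary o-minimal structure on $(\mathbf{R}, +, \cdot)$, and let $f : \mathbf{R}^n \to \mathbf{R}$ be a smooth function definable in $\mathcal{D}$. Then $\Sigma_f$ and $S_f$ are finite sets.
   Context: Smooth means $C^\infty$. An o-minimal structure on the real field $(\mathbf{R}, +, \cdot)$ is a family $\mathcal{D} = (\mathcal{D}_n)_{n \in \mathbf{N}}$ such that for each $n \in \mathbf{N}$: - (D1) $\mathcal{D}_n$ is a boolean algebra of subsets of $\mathbf{R}^n$ (closed under complements and finite unions). - (D2) If $A \in \mathcal{D}_n$, then $A \times \mathbf{R} \in \mathcal{D}_{n+1}$ and $\mathbf{R} \times A \in \mathcal{D}_{n+1}$. - (D3) If $A \in \mathcal{D}_{n+1}$, then $\pi(A) \in \mathcal{D}_n$, where $\pi : \mathbf{R}^{n+1} \to \mathbf{R}^n$ is the projection on the first $n$ coordinates. - (D4) $\mathcal{D}_n$ contains $\{x \in \mathbf{R}^n \mid P(x) = 0\}$ for every polynomial $P \in \mathbf{R}[X_1, \ldots, X_n]$. - (D5) Each set belonging to $\mathcal{D}_1$ is a finite union of intervals (possibly unbounded) and points. A set $A \subseteq \mathbf{R}^n$ is definable (in $\mathcal{D}$) if $A \in \mathcal{D}_n$; a map is definable if its graph is a definable set. For a smooth function $f : \mathbf{R}^n \to \mathbf{R}$: - $\Sigma_f$ is the set of critical values of $f$, i.e. $\Sigma_f = \{ f(x) \mid x \in \mathbf{R}^n, \operatorname{grad} f(x) = 0 \}$. - $M(f) := \{ x \in \mathbf{R}^n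 \mid \exists \lambda \in \mathbf{R},\ \operatorname{grad} f(x) = \lambda x \}$. - $S_f$ is the set of all $c \in \mathbf{R}$ for which there exists a sequence $\{y^k\} \subseteq M(f)$ with $\lim_{k\to\infty} \|y^k\| = \infty$ and $\lim_{k \to \infty} f(y^k) = c$. Here $\|\cdot\|$ is the Euclidean norm. *)

theory Defs
  imports "HOL-Analysis.Analysis"
begin

text \<open>
  An o-minimal structure lives on all the spaces of coordinate tuples at once, so there these spaces
  are represented by lists: \<open>tuples n\<close> are the real lists of length \<open>n\<close>. The functions
  under consideration are defined on the Euclidean space \<open>real ^ 'n\<close>; the two representations
  are connected by \<open>coords\<close> below.
\<close>

definition tuples :: "nat \<Rightarrow> real list set" where
  "tuples n = {x. length x = n}"

text \<open>
  A real polynomial in the variables \<open>X\<^sub>0, \<dots>, X\<^sub>n\<^sub>-\<^sub>1\<close> is given by a finite set \<open>A\<close> of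
  multi-indices and the coefficients \<open>c\<close>. Values \<open>\<alpha> i\<close> with \<open>i \<ge> n\<close> are
  irrelevant, so different multi-indices may stand for the same monomial; their coefficients add up.
\<close>

definition eval_poly :: "nat \<Rightarrow> (nat \<Rightarrow> nat) set \<Rightarrow> ((nat \<Rightarrow> nat) \<Rightarrow> real) \<Rightarrow> real list \<Rightarrow> real" where
  "eval_poly n A c x = (\<Sum>\<alpha>\<in>A. c \<alpha> * (\<Prod>i<n. (x ! i) ^ \<alpha> i))"

text \<open>
  In \<open>tame\<close>, \<^const>\<open>is_interval\<close> covers bounded and unbounded intervals of any kind, and
  points as degenerate intervals.
\<close>

locale o_minimal_structure =
  fixes D :: "nat \<Rightarrow> real list set set"
  assumes boolean_algebra: "algebra (tuples n) (D n)"
    and times_line: "A \<in> D n \<Longrightarrow> {x @ [t] | x t. x \<in> A} \<in> D (Suc n)"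
    and line_times: "A \<in> D n \<Longrightarrow> {t # x | t x. x \<in> A} \<in> D (Suc n)"
    and projection: "A \<in> D (Suc n) \<Longrightarrow> take n ` A \<in> D n"
    and zero_set: "finite I \<Longrightarrow> {x \<in> tuples n. eval_poly n I c x = 0} \<in> D n"
    and tame: "A \<in> D 1 \<Longrightarrow>
      \<exists>\<J>. finite \<J> \<and> (\<forall>J\<in>\<J>. is_interval J) \<and> {t. [t] \<in> A} = \<Union>\<J>"

text \<open>
  The enumeration \<open>e\<close> of the index type fixes the order of the coordinates; it is meant to be
  a bijection from \<open>{..<CARD('n)}\<close> onto \<open>UNIV\<close>.
\<close>

definition coords :: "(nat \<Rightarrow> 'n::finite) \<Rightarrow> real ^ 'n \<Rightarrow> real list" where
  "coords e x = map (\<lambda>i. x $ e i) [0..<CARD('n)]"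

definition definable_fun ::
    "(nat \<Rightarrow> real list set set) \<Rightarrow> (nat \<Rightarrow> 'n::finite) \<Rightarrow> (real ^ 'n \<Rightarrow> real) \<Rightarrow> bool" where
  "definable_fun D e f \<longleftrightarrow> range (\<lambda>x. coords e x @ [f x]) \<in> D (Suc CARD('n))"

text \<open>
  On a Euclidean space, having continuous derivatives up to order \<open>k\<close> can be tested on the
  directional derivatives.
\<close>

primrec continuously_differentiable ::
    "nat \<Rightarrow> ('a::euclidean_space \<Rightarrow> 'b::real_normed_vector) \<Rightarrow> bool" where
  "continuously_differentiable 0 f \<longleftrightarrow> continuous_on UNIV f"
| "continuously_differentiable (Suc k) f \<longleftrightarrow>
     (\<forall>x. f differentiable (at x)) \<and>
     (\<forall>v. continuously_differentiable k (\<lambda>x. frechet_derivative f (at x) v))"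

definition smooth :: "('a::euclidean_space \<Rightarrow> 'b::real_normed_vector) \<Rightarrow> bool" where
  "smooth f \<longleftrightarrow> (\<forall>k. continuously_differentiable k f)"

definition grad :: "('a::euclidean_space \<Rightarrow> real) \<Rightarrow> 'a \<Rightarrow> 'a" where
  "grad f x = (THE g. GDERIV f x :> g)"

definition critical_values :: "('a::euclidean_space \<Rightarrow> real) \<Rightarrow> real set" where
  "critical_values f = {f x | x. grad f x = 0}"

definition M_set :: "('a::euclidean_space \<Rightarrow> real) \<Rightarrow> 'a set" where
  "M_set f = {x. \<exists>l::real. grad f x = l *\<^sub>R x}"

definition S_set :: "('a::euclidean_space \<Rightarrow> real) \<Rightarrow> real set" where
  "S_set f = {c. \<exists>y :: nat \<Rightarrow> 'a. (\<forall>k. y k \<in> M_set f) \<and>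
     filterlim (\<lambda>k. norm (y k)) at_top sequentially \<and> (\<lambda>k. f (y k)) \<longlonglongrightarrow> c}"

end

theory Submission
  imports Defs
begin

text \<open>
Both finiteness claims rest on one elementary obstruction, which replaces the usual appeal to
continuously differentiable definable curves. Let \<open>A\<close> be a bounded definable set such that
\<open>\<bar>f y - f x\<bar> \<le> K * (norm (y - x))\<^sup>2\<close> for all \<open>x\<close> and \<open>y\<close> in \<open>A\<close>. Then \<open>f\<close> takes
only finitely many values on \<open>A\<close> (\<open>finite_image_of_quadratic_points\<close>). Otherwise the values
contain an interval, and one can select for every \<open>t\<close> in some smaller interval a point
\<open>x t\<close> of the closure of \<open>A\<close> with value \<open>t\<close> so that all coordinates of \<open>x t\<close> are
monotone in \<open>t\<close>. Such a curve has finite length. Cut the interval into \<open>N\<close> equal pieces: each piece of length of order \<open>1 / N\<close>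
forces \<open>x\<close> to move by a distance of order \<open>1 / sqrt N\<close>, so the length is at least of order
\<open>sqrt N\<close>, a contradiction for large \<open>N\<close>. Monotonicity comes from o-minimality
(\<open>monotone_on_subinterval\<close>): the local behaviour of a definable function to the left and to
the right of a point is one of nine types, one type prevails on an interval, and the types that
are not monotone are excluded since a function has only countably many strict local extrema.

At a critical point \<open>x\<close> Taylor's formula bounds \<open>f y - f x\<close> by a multiple of
\<open>(norm (y - x))\<^sup>2\<close> for all \<open>y\<close> no farther from the origin than \<open>x\<close>. The same is true at the
points of \<^const>\<open>M_set\<close> if \<open>y\<close> is confined to the sphere through \<open>x\<close>, because there the linear
term \<open>l * (x \<bullet> (y - x))\<close> is quadratic as well. The points with such a bound form definable
sets, whose definition does not mention derivatives. Letting the constant and the radius run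
through the natural numbers, one finds that the critical values are contained in a definable
countable set, which must be finite, and that on each sphere around the origin
\<open>f\<close> takes only countably many values at the points with the weaker bound.

For the limit values at infinity let \<open>V\<close> be the set of all pairs \<open>(norm x, f x)\<close>, where
\<open>x\<close> satisfies such a bound on its sphere. If a whole interval consisted of limit values, then by tameness all but countably many \<open>c\<close>
in the interval would belong to the fibres of \<open>V\<close> over all large radii, in particular over
some natural number; but the fibres over natural numbers are countable
(\<open>finite_limits_at_infinity\<close>).
\<close>

section \<open>Definable sets of coordinate tuples\<close>

context o_minimal_structure
begin

lemma zero_set_affine: "{x \<in> tuples n. c0 + (\<Sum>i<n. d i * x ! i) = 0} \<in> D n"
proof -
  define \<delta> :: "nat \<Rightarrow> nat \<Rightarrow> nat" where "\<delta> i = (\<lambda>k. if k = i then 1 else 0)" for i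
  \<comment> \<open>The least index at which \<open>\<delta> i\<close> is positive recovers \<open>i\<close>.\<close>
  define c where "c \<alpha> = (if \<alpha> = (\<lambda>_. 0) then c0 else d (LEAST i. 0 < \<alpha> i))" for \<alpha> :: "nat \<Rightarrow> nat"
  let ?I = "insert (\<lambda>_. 0) (\<delta> ` {..<n})"
  have ne: "\<delta> i \<noteq> (\<lambda>_. 0)" for i
    by (auto simp: \<delta>_def fun_eq_iff)
  have inj: "inj_on \<delta> {..<n}"
    by (rule inj_onI) (metis \<delta>_def zero_neq_one)
  have least: "(LEAST k. 0 < \<delta> i k) = i" for i
    by (rule Least_equality) (auto simp: \<delta>_def split: if_splits)
  have mono: "(\<Prod>k<n. x ! k ^ \<delta> i k) = x ! i" if "i < n" for i and x :: "real list"
  proof -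
    have "(\<Prod>k<n. x ! k ^ \<delta> i k) = (\<Prod>k<n. if k = i then x ! k else 1)"
      by (intro prod.cong) (auto simp: \<delta>_def)
    then show ?thesis using that by simp
  qed
  have "eval_poly n ?I c x = c0 + (\<Sum>i<n. d i * x ! i)" for x
  proof -
    have "eval_poly n ?I c x = c0 + (\<Sum>\<alpha>\<in>\<delta> ` {..<n}. c \<alpha> * (\<Prod>i<n. x ! i ^ \<alpha> i))"
      unfolding eval_poly_def using ne by (subst sum.insert) (auto simp: c_def image_iff, metis)
    also have "(\<Sum>\<alpha>\<in>\<delta> ` {..<n}. c \<alpha> * (\<Prod>i<n. x ! i ^ \<alpha> i)) = (\<Sum>i<n. d i * x ! i)"
      using inj by (simp add: sum.reindex c_def ne least mono)
    finally show ?thesis .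
  qed
  then show ?thesis using zero_set[of ?I n c] by simp
qed

lemma graph_of_product: "{x \<in> tuples 3. x ! 0 * x ! 1 = x ! 2} \<in> D 3"
proof -
  define \<alpha> :: "nat \<Rightarrow> nat" where "\<alpha> = (\<lambda>k. if k = 2 then 0 else 1)"
  define \<beta> :: "nat \<Rightarrow> nat" where "\<beta> = (\<lambda>k. if k = 2 then 1 else 0)"
  define c :: "(nat \<Rightarrow> nat) \<Rightarrow> real" where "c \<gamma> = (if \<gamma> = \<alpha> then 1 else - 1)" for \<gamma>
  have "\<alpha> \<noteq> \<beta>" by (auto simp: \<alpha>_def \<beta>_def fun_eq_iff)
  then have "eval_poly 3 {\<alpha>, \<beta>} c x = x ! 0 * x ! 1 - x ! 2" for x
    by (simp add: eval_poly_def c_def \<alpha>_def \<beta>_def lessThan_Suc numeral_3_eq_3 numeral_2_eq_2)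
  then show ?thesis using zero_set[of "{\<alpha>, \<beta>}" 3 c] by simp
qed

lemma member_tuples: "A \<in> D n \<Longrightarrow> x \<in> A \<Longrightarrow> length x = n"
  using boolean_algebra[of n] by (auto simp: algebra_iff_Un tuples_def)

lemma tuples_times:
  assumes "A \<in> D m"
  shows "{x @ y | x y. length x = n \<and> y \<in> A} \<in> D (n + m)"
proof (induction n)
  case 0
  then show ?case using assms by simp
next
  case (Suc n)
  have "{t # z | t z. z \<in> {x @ y | x y. length x = n \<and> y \<in> A}} =
        {x @ y | x y. length x = Suc n \<and> y \<in> A}" (is "?L = ?R")
  proof
    show "?L \<subseteq> ?R"
      by clarsimp (metis append_Cons length_Cons)
    show "?R \<subseteq> ?L"
      by (fastforce simp: length_Suc_conv)
  qed
  then show ?case using line_times[OF Suc.IH] by simp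
qed

lemma projection_iterated: "A \<in> D (n + m) \<Longrightarrow> take n ` A \<in> D n"
proof (induction m arbitrary: A)
  case 0
  have "take n ` A = A"
    using member_tuples[OF 0] by force
  then show ?case using 0 by simp
next
  case (Suc m)
  have "take n ` take (n + m) ` A = take n ` A"
    by (simp add: image_image)
  then show ?case
    using Suc.IH[of "take (n + m) ` A"] projection[of A "n + m"] Suc.prems by simp
qed

text \<open>
The graph of a linear map \<open>L\<close> is cut out by finitely many polynomial equations, so
\<open>L -` A\<close> is the projection of the definable set \<open>{x @ y | y \<in> A} \<inter> {x @ L x}\<close>. This covers
permutation, duplication and omission of coordinates in one go.
\<close>

lemma linear_preimage_tuples:
  assumes "A \<in> D m"
  shows "{x \<in> tuples n. map (\<lambda>j. \<Sum>i<n. c j i * x ! i) [0..<m] \<in> A} \<in> D n"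
proof -
  interpret algebra "tuples (n + m)" "D (n + m)" by (rule boolean_algebra)
  define L where "L x = map (\<lambda>j. \<Sum>i<n. c j i * x ! i) [0..<m]" for x :: "real list"
  \<comment> \<open>Over \<open>?Z \<inter> ?G\<close> the last \<open>m\<close> coordinates are the image of the first \<open>n\<close>.\<close>
  let ?Z = "{x @ y | x y. length x = n \<and> y \<in> A}"
  let ?G = "{z \<in> tuples (n + m). \<forall>j\<in>{..<m}. (\<Sum>i<n. c j i * z ! i) = z ! (n + j)}"
  have "{z \<in> tuples (n + m). (\<Sum>i<n. c j i * z ! i) = z ! (n + j)} \<in> D (n + m)" if "j < m" for j
  proof -
    let ?d = "\<lambda>i. if i < n then c j i else if i = n + j then - 1 else 0"
    have "(\<Sum>i<n + m. ?d i * z ! i) = (\<Sum>i<n. c j i * z ! i) - z ! (n + j)" for z :: "real list"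
    proof -
      have "(\<Sum>i<n + m. ?d i * z ! i) = (\<Sum>i<n. ?d i * z ! i) + (\<Sum>i=n..<n + m. ?d i * z ! i)"
        using sum.atLeastLessThan_concat[of 0 n "n + m" "\<lambda>i. ?d i * z ! i"]
        by (simp only: lessThan_atLeast0)
      also have "(\<Sum>i=n..<n + m. ?d i * z ! i) = (\<Sum>i=n..<n + m. if i = n + j then - z ! i else 0)"
        by (intro sum.cong) auto
      also have "\<dots> = - z ! (n + j)" using that by simp
      finally show ?thesis by simp
    qed
    then show ?thesis using zero_set_affine[of "n + m" 0 ?d] by simp
  qed
  then have "?G \<in> D (n + m)" by (intro sets_Collect_finite_All) auto
  then have "?Z \<inter> ?G \<in> D (n + m)" using tuples_times[OF assms] by blast
  moreover have "take n ` (?Z \<inter> ?G) = {x \<in> tuples n. L x \<in> A}"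
  proof (intro set_eqI iffI)
    fix x assume "x \<in> take n ` (?Z \<inter> ?G)"
    then obtain y where "length x = n" "y \<in> A" and G: "x @ y \<in> ?G" by force
    have "y ! j = (\<Sum>i<n. c j i * x ! i)" if "j < m" for j
      using G that \<open>length x = n\<close> by (auto simp: nth_append)
    then have "y = L x"
      using member_tuples[OF assms \<open>y \<in> A\<close>] by (intro nth_equalityI) (auto simp: L_def)
    then show "x \<in> {x \<in> tuples n. L x \<in> A}"
      using \<open>length x = n\<close> \<open>y \<in> A\<close> by (simp add: tuples_def)
  next
    fix x assume "x \<in> {x \<in> tuples n. L x \<in> A}"
    then have "length x = n" "L x \<in> A" by (auto simp: tuples_def)
    moreover have "(\<Sum>i<n. c j i * (x @ L x) ! i) = (x @ L x) ! (n + j)" if "j < m" for j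
    proof -
      have "(\<Sum>i<n. c j i * (x @ L x) ! i) = (\<Sum>i<n. c j i * x ! i)"
        using \<open>length x = n\<close> by (intro sum.cong) (auto simp: nth_append)
      then show ?thesis using that \<open>length x = n\<close> by (simp add: L_def nth_append)
    qed
    ultimately have "x @ L x \<in> ?Z \<inter> ?G"
      by (auto simp: tuples_def L_def)
    then show "x \<in> take n ` (?Z \<inter> ?G)"
      using \<open>length x = n\<close> by force
  qed
  ultimately show ?thesis using projection_iterated by (metis (no_types, lifting) L_def Collect_cong)
qed

end

section \<open>Coordinates of a Euclidean space\<close>

definition coordinates :: "'a::euclidean_space list \<Rightarrow> 'a \<Rightarrow> real list" where
  "coordinates bs x = map (\<lambda>b. x \<bullet> b) bs"

text \<open>
A basis list is an enumeration of the standard basis. The order is left open, since the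
coordinate order turns out to be immaterial for definability.
\<close>

definition basis_list :: "'a::euclidean_space list \<Rightarrow> bool" where
  "basis_list bs \<longleftrightarrow> distinct bs \<and> set bs = Basis"

lemma basis_list_exists: "\<exists>bs :: 'a::euclidean_space list. basis_list bs"
  using finite_distinct_list[OF finite_Basis] by (auto simp: basis_list_def)

lemma length_basis_list: "basis_list (bs :: 'a::euclidean_space list) \<Longrightarrow> length bs = DIM('a)"
  by (metis basis_list_def distinct_card)

lemma length_coordinates [simp]: "length (coordinates bs x) = length bs"
  by (simp add: coordinates_def)

lemma sum_basis_list:
  "basis_list (bs :: 'a::euclidean_space list) \<Longrightarrow> (\<Sum>b\<in>Basis. h b) = (\<Sum>i<DIM('a). h (bs ! i))"
  by (metis basis_list_def length_basis_list lessThan_atLeast0 sum.reindex_bij_betw bij_betw_nth)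

lemma inj_coordinates: "basis_list bs \<Longrightarrow> inj (coordinates bs)"
  by (rule injI) (auto simp: basis_list_def coordinates_def intro: euclidean_eqI)

lemma surj_coordinates:
  assumes bs: "basis_list (bs :: 'a::euclidean_space list)" and "length x = DIM('a)"
  obtains y where "coordinates bs y = x"
proof
  have mem: "bs ! i \<in> Basis" if "i < DIM('a)" for i
    using bs length_basis_list[OF bs] that by (metis basis_list_def nth_mem)
  have "(\<Sum>i<DIM('a). x ! i *\<^sub>R bs ! i) \<bullet> bs ! j = x ! j" if "j < DIM('a)" for j
  proof -
    have "(\<Sum>i<DIM('a). x ! i *\<^sub>R bs ! i) \<bullet> bs ! j = (\<Sum>i<DIM('a). if i = j then x ! i else 0)"
      unfolding inner_sum_left using bs that mem length_basis_list[OF bs]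
      by (intro sum.cong) (auto simp: basis_list_def inner_Basis nth_eq_iff_index_eq)
    then show ?thesis using that by simp
  qed
  then show "coordinates bs (\<Sum>i<DIM('a). x ! i *\<^sub>R bs ! i) = x"
    using assms(2) length_basis_list[OF bs] by (intro nth_equalityI) (auto simp: coordinates_def)
qed

lemma range_coordinates:
  "basis_list (bs :: 'a::euclidean_space list) \<Longrightarrow> range (coordinates bs) = tuples DIM('a)"
  by (auto simp: tuples_def length_basis_list intro: surj_coordinates)

section \<open>Definable subsets of Euclidean spaces\<close>

context o_minimal_structure
begin

text \<open>
Definability is transferred to arbitrary Euclidean spaces, so that formulas with several
variables can be written with pairs instead of list positions. Asking for some basis list is the
same as asking for every one, as \<open>definable_iff_coordinates\<close> shows.
\<close>

definition definable :: "'a::euclidean_space set \<Rightarrow> bool" where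
  "definable A \<longleftrightarrow> (\<exists>bs. basis_list bs \<and> coordinates bs ` A \<in> D DIM('a))"

text \<open>
With \<open>L\<close> the identity this says that changing the basis list preserves definability, because
\<open>bs\<close> is arbitrary while the list witnessing \<open>definable A\<close> is another one.
\<close>

lemma linear_preimage_coordinates:
  fixes L :: "'a::euclidean_space \<Rightarrow> 'b::euclidean_space"
  assumes "linear L" "definable A" and bs: "basis_list bs"
  shows "coordinates bs ` (L -` A) \<in> D DIM('a)"
proof -
  obtain cs where cs: "basis_list cs" and A: "coordinates cs ` A \<in> D DIM('b)"
    using assms by (auto simp: definable_def)
  let ?c = "\<lambda>j i. L (bs ! i) \<bullet> cs ! j"
  have L: "map (\<lambda>j. \<Sum>i<DIM('a). ?c j i * coordinates bs x ! i) [0..<DIM('b)] = coordinates cs (L x)" for x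
  proof (rule nth_equalityI)
    show "length (map (\<lambda>j. \<Sum>i<DIM('a). ?c j i * coordinates bs x ! i) [0..<DIM('b)]) =
        length (coordinates cs (L x))"
      using length_basis_list[OF cs] by simp
    fix j assume "j < length (map (\<lambda>j. \<Sum>i<DIM('a). ?c j i * coordinates bs x ! i) [0..<DIM('b)])"
    then have j: "j < DIM('b)" by simp
    have "L x = L (\<Sum>b\<in>Basis. (x \<bullet> b) *\<^sub>R b)" by (simp add: euclidean_representation)
    also have "\<dots> = (\<Sum>b\<in>Basis. (x \<bullet> b) *\<^sub>R L b)"
      using \<open>linear L\<close> by (simp add: linear_sum linear_scale)
    also have "\<dots> = (\<Sum>i<DIM('a). (x \<bullet> bs ! i) *\<^sub>R L (bs ! i))" by (rule sum_basis_list[OF bs])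
    finally have "L x \<bullet> cs ! j = (\<Sum>i<DIM('a). ?c j i * (x \<bullet> bs ! i))"
      by (simp add: inner_sum_left mult.commute)
    then show "map (\<lambda>j. \<Sum>i<DIM('a). ?c j i * coordinates bs x ! i) [0..<DIM('b)] ! j =
        coordinates cs (L x) ! j"
      using j length_basis_list[OF cs] length_basis_list[OF bs] by (simp add: coordinates_def)
  qed
  have "coordinates bs ` (L -` A) = {z \<in> tuples DIM('a).
      map (\<lambda>j. \<Sum>i<DIM('a). ?c j i * z ! i) [0..<DIM('b)] \<in> coordinates cs ` A}" (is "?l = ?r")
  proof (intro set_eqI iffI)
    fix z assume "z \<in> ?l"
    then show "z \<in> ?r" using L length_basis_list[OF bs] by (auto simp: tuples_def)
  next
    fix z assume z: "z \<in> ?r"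
    then obtain x where x: "coordinates bs x = z"
      using surj_coordinates[OF bs, of z] by (auto simp: tuples_def)
    then have "coordinates cs (L x) \<in> coordinates cs ` A" using L[of x] z by simp
    then have "L x \<in> A" using inj_coordinates[OF cs] by (simp add: inj_image_mem_iff)
    then show "z \<in> ?l" using x by blast
  qed
  then show ?thesis using linear_preimage_tuples[OF A, of "DIM('a)" ?c] by simp
qed

lemma definable_iff_coordinates:
  fixes A :: "'a::euclidean_space set"
  assumes "basis_list bs"
  shows "definable A \<longleftrightarrow> coordinates bs ` A \<in> D DIM('a)"
  using linear_preimage_coordinates[of "\<lambda>x. x" A bs] assms by (auto simp: definable_def linear_id[unfolded id_def])

lemma definable_vimage_linear: "linear L \<Longrightarrow> definable A \<Longrightarrow> definable (L -` A)"
  using linear_preimage_coordinates basis_list_exists definable_def by blast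

lemma definable_Compl:
  fixes A :: "'a::euclidean_space set"
  assumes "definable A" shows "definable (- A)"
proof -
  obtain bs :: "'a list" where bs: "basis_list bs" using basis_list_exists by blast
  interpret algebra "tuples DIM('a)" "D DIM('a)" by (rule boolean_algebra)
  have "coordinates bs ` (- A) = tuples DIM('a) - coordinates bs ` A"
    unfolding range_coordinates[OF bs, symmetric] Compl_eq_Diff_UNIV
    by (rule image_set_diff[OF inj_coordinates[OF bs]])
  then show ?thesis using assms compl_sets by (simp add: definable_iff_coordinates[OF bs])
qed

lemma definable_Int:
  fixes A :: "'a::euclidean_space set"
  assumes "definable A" "definable B" shows "definable (A \<inter> B)"
proof -
  obtain bs :: "'a list" where bs: "basis_list bs" using basis_list_exists by blast
  interpret algebra "tuples DIM('a)" "D DIM('a)" by (rule boolean_algebra)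
  show ?thesis
    using assms inj_coordinates[OF bs] by (simp add: definable_iff_coordinates[OF bs] image_Int Int)
qed

lemma definable_fst_image:
  fixes A :: "('a::euclidean_space \<times> 'b::euclidean_space) set"
  assumes "definable A" shows "definable (fst ` A)"
proof -
  obtain bs :: "'a list" where bs: "basis_list bs" using basis_list_exists by blast
  obtain cs :: "'b list" where cs: "basis_list cs" using basis_list_exists by blast
  let ?l = "map (\<lambda>b. (b, 0)) bs @ map (\<lambda>c. (0, c)) cs"
  have "basis_list ?l"
    using bs cs by (auto simp: basis_list_def distinct_map inj_on_def Basis_prod_def)
  then have "coordinates ?l ` A \<in> D (DIM('a) + DIM('b))"
    using assms by (simp add: definable_iff_coordinates)
  moreover have "take DIM('a) (coordinates ?l p) = coordinates bs (fst p)" for p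
    using length_basis_list[OF bs] by (cases p) (simp add: coordinates_def)
  ultimately show ?thesis
    using projection_iterated[of "coordinates ?l ` A" "DIM('a)" "DIM('b)"]
    by (simp add: definable_iff_coordinates[OF bs] image_image)
qed

lemma definable_real_iff: "definable (A :: real set) \<longleftrightarrow> (\<lambda>t. [t]) ` A \<in> D 1"
  by (subst definable_iff_coordinates[of "[1]"]) (simp_all add: basis_list_def coordinates_def)

lemma definable_singleton: "definable {c :: real}"
proof -
  have "(\<lambda>t. [t]) ` {c} = {x \<in> tuples 1. - c + (\<Sum>i<1. 1 * x ! i) = 0}"
    by (auto simp: tuples_def length_Suc_conv)
  then show ?thesis
    unfolding definable_real_iff using zero_set_affine[of 1 "- c" "\<lambda>_. 1"] by simp
qed

lemma definable_graph_times: "definable {(x, y, z :: real). z = x * y}"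
proof -
  let ?l = "[(1, 0, 0), (0, 1, 0), (0, 0, 1)] :: (real \<times> real \<times> real) list"
  have "basis_list ?l" by (auto simp: basis_list_def Basis_prod_def zero_prod_def)
  moreover have "coordinates ?l ` {(x, y, z). z = x * y} = {x \<in> tuples 3. x ! 0 * x ! 1 = x ! 2}"
    by (force simp: coordinates_def tuples_def length_Suc_conv numeral_3_eq_3 numeral_2_eq_2 image_iff)
  ultimately show ?thesis using graph_of_product by (simp add: definable_iff_coordinates numeral_3_eq_3)
qed

text \<open>
The closure properties are stated for set comprehensions. In this form they act as introduction
rules, one for each logical connective and quantifier, and the definability of a set given by a
first-order formula is proved by following its syntax.
\<close>

lemma definable_conj:
  "definable {x. P x} \<Longrightarrow> definable {x. Q x} \<Longrightarrow> definable {x. P x \<and> Q x}"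
  using definable_Int[of "{x. P x}" "{x. Q x}"] by (simp add: Collect_conj_eq)

lemma definable_not: "definable {x. P x} \<Longrightarrow> definable {x. \<not> P x}"
  using definable_Compl[of "{x. P x}"] by (simp add: Collect_neg_eq)

lemma definable_disj:
  "definable {x. P x} \<Longrightarrow> definable {x. Q x} \<Longrightarrow> definable {x. P x \<or> Q x}"
  using definable_not[OF definable_conj[OF definable_not[of P] definable_not[of Q]]] by simp

lemma definable_imp:
  "definable {x. P x} \<Longrightarrow> definable {x. Q x} \<Longrightarrow> definable {x. P x \<longrightarrow> Q x}"
  using definable_disj[OF definable_not[of P], of Q] by (simp only: imp_conv_disj)

text \<open>
A quantifier over a vector is a projection along a factor of a product space.
\<close>

lemma definable_ex:
  fixes P :: "'a::euclidean_space \<Rightarrow> 'b::euclidean_space \<Rightarrow> bool"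
  assumes "definable {p. P (fst p) (snd p)}"
  shows "definable {x. \<exists>y. P x y}"
proof -
  have "{x. \<exists>y. P x y} = fst ` {p. P (fst p) (snd p)}" by (auto simp: image_iff)
  then show ?thesis using definable_fst_image[OF assms] by simp
qed

lemma definable_all:
  fixes P :: "'a::euclidean_space \<Rightarrow> 'b::euclidean_space \<Rightarrow> bool"
  assumes "definable {p. P (fst p) (snd p)}"
  shows "definable {x. \<forall>y. P x y}"
  using definable_not[OF definable_ex[of "\<lambda>x y. \<not> P x y"]] definable_not[OF assms] by simp

lemma definable_substitute: "linear L \<Longrightarrow> definable {x. P x} \<Longrightarrow> definable {x. P (L x)}"
  using definable_vimage_linear[of L "{x. P x}"] by (simp add: vimage_def)

lemma definable_vimage_singleton:
  assumes "linear (L :: 'a::euclidean_space \<Rightarrow> real)" shows "definable {x. L x = c}"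
  using definable_vimage_linear[OF assms definable_singleton[of c]] by (simp add: vimage_def)

lemma definable_UNIV: "definable UNIV"
  using definable_vimage_singleton[of "\<lambda>_. 0" 0] by (simp add: linear_zero)

lemma definable_ball_finite:
  "finite S \<Longrightarrow> (\<And>i. i \<in> S \<Longrightarrow> definable {x. P i x}) \<Longrightarrow> definable {x. \<forall>i\<in>S. P i x}"
  by (induction S rule: finite_induct) (simp_all add: definable_UNIV definable_conj)

lemma definable_zero: "definable {0 :: 'a::euclidean_space}"
proof -
  have "{0 :: 'a} = {x. \<forall>b\<in>Basis. x \<bullet> b = 0}"
    using euclidean_all_zero_iff by auto
  moreover have "definable {x :: 'a. \<forall>b\<in>Basis. x \<bullet> b = 0}"
    by (intro definable_ball_finite definable_vimage_singleton)
       (auto intro!: linearI simp: inner_add_left)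
  ultimately show ?thesis by simp
qed

section \<open>Definable maps and first-order formulas\<close>

definition definable_map :: "('a::euclidean_space \<Rightarrow> 'b::euclidean_space) \<Rightarrow> bool" where
  "definable_map F \<longleftrightarrow> definable {p. snd p = F (fst p)}"

lemma definable_map_linear:
  assumes "linear F" shows "definable_map F"
proof -
  interpret linear F by fact
  have "linear (\<lambda>p. snd p - F (fst p))"
    by (rule linearI) (simp_all add: add scale algebra_simps)
  from definable_vimage_linear[OF this definable_zero] show ?thesis
    by (simp add: definable_map_def vimage_def)
qed

text \<open>
The preimage of \<open>A\<close> is the projection of the part of the graph that lies over \<open>A\<close>.
\<close>

lemma definable_member:
  fixes F :: "'a::euclidean_space \<Rightarrow> 'b::euclidean_space"
  assumes "definable A" "definable_map F"
  shows "definable {x. F x \<in> A}"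
proof -
  have "definable {p :: 'a \<times> 'b. snd p \<in> A}"
    using definable_vimage_linear[of snd A] assms(1) by (simp add: vimage_def linear_snd)
  then have "definable {x. \<exists>y. y = F x \<and> y \<in> A}"
    using assms(2) unfolding definable_map_def by (intro definable_ex definable_conj)
  then show ?thesis by simp
qed

lemma definable_map_compose:
  fixes F :: "'a::euclidean_space \<Rightarrow> 'b::euclidean_space" and G :: "'b \<Rightarrow> 'c::euclidean_space"
  assumes "definable_map F" "definable_map G"
  shows "definable_map (\<lambda>x. G (F x))"
proof -
  have "definable {q :: ('a \<times> 'c) \<times> 'b. snd q = F (fst (fst q))}"
  proof -
    have "linear (\<lambda>q :: ('a \<times> 'c) \<times> 'b. (fst (fst q), snd q))" by (rule linearI) (simp_all add: prod_eq_iff)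
    from definable_substitute[OF this assms(1)[unfolded definable_map_def]] show ?thesis by simp
  qed
  moreover have "definable {q :: ('a \<times> 'c) \<times> 'b. snd (fst q) = G (snd q)}"
  proof -
    have "linear (\<lambda>q :: ('a \<times> 'c) \<times> 'b. (snd q, snd (fst q)))" by (rule linearI) (simp_all add: prod_eq_iff)
    from definable_substitute[OF this assms(2)[unfolded definable_map_def]] show ?thesis by simp
  qed
  ultimately have "definable {p. \<exists>y. y = F (fst p) \<and> snd p = G y}"
    by (intro definable_ex definable_conj)
  then show ?thesis by (simp add: definable_map_def)
qed

lemma definable_map_Pair:
  fixes F :: "'a::euclidean_space \<Rightarrow> 'b::euclidean_space" and G :: "'a \<Rightarrow> 'c::euclidean_space"
  assumes "definable_map F" "definable_map G"
  shows "definable_map (\<lambda>x. (F x, G x))"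
proof -
  have "definable {p :: 'a \<times> 'b \<times> 'c. fst (snd p) = F (fst p)}"
  proof -
    have "linear (\<lambda>p :: 'a \<times> 'b \<times> 'c. (fst p, fst (snd p)))" by (rule linearI) (simp_all add: prod_eq_iff)
    from definable_substitute[OF this assms(1)[unfolded definable_map_def]] show ?thesis by simp
  qed
  moreover have "definable {p :: 'a \<times> 'b \<times> 'c. snd (snd p) = G (fst p)}"
  proof -
    have "linear (\<lambda>p :: 'a \<times> 'b \<times> 'c. (fst p, snd (snd p)))" by (rule linearI) (simp_all add: prod_eq_iff)
    from definable_substitute[OF this assms(2)[unfolded definable_map_def]] show ?thesis by simp
  qed
  ultimately show ?thesis
    using definable_conj by (fastforce simp: definable_map_def prod_eq_iff)
qed

lemma definable_map_linear_compose:
  "linear L \<Longrightarrow> definable_map F \<Longrightarrow> definable_map (\<lambda>x. L (F x))"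
  by (rule definable_map_compose[OF _ definable_map_linear])

lemma definable_map_id: "definable_map (\<lambda>x. x)"
  by (rule definable_map_linear[OF linear_id[unfolded id_def]])

lemma definable_map_fst: "definable_map F \<Longrightarrow> definable_map (\<lambda>x. fst (F x))"
  and definable_map_snd: "definable_map F \<Longrightarrow> definable_map (\<lambda>x. snd (F x))"
  by (rule definable_map_linear_compose; simp add: linear_fst linear_snd)+

lemma definable_eq:
  assumes "definable_map F" "definable_map G"
  shows "definable {x. F x = G x}"
proof -
  have "linear (\<lambda>p. fst p - snd p)" by (rule linearI) (simp_all add: algebra_simps)
  from definable_map_linear_compose[OF this definable_map_Pair[OF assms]]
  show ?thesis using definable_member[OF definable_zero] by fastforce
qed

lemma definable_map_const_real: "definable_map (\<lambda>_. c :: real)"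
  unfolding definable_map_def by (rule definable_vimage_singleton) (rule linear_snd)

lemma definable_map_add:
  assumes "definable_map F" "definable_map G" shows "definable_map (\<lambda>x. F x + G x)"
proof -
  have "linear (\<lambda>p. fst p + snd p)" by (rule linearI) (simp_all add: algebra_simps)
  from definable_map_linear_compose[OF this definable_map_Pair[OF assms]] show ?thesis by simp
qed

lemma definable_map_diff:
  assumes "definable_map F" "definable_map G" shows "definable_map (\<lambda>x. F x - G x)"
proof -
  have "linear (\<lambda>p. fst p - snd p)" by (rule linearI) (simp_all add: algebra_simps)
  from definable_map_linear_compose[OF this definable_map_Pair[OF assms]] show ?thesis by simp
qed

lemma definable_map_times:
  assumes "definable_map F" "definable_map (G :: _ \<Rightarrow> real)"
  shows "definable_map (\<lambda>x. F x * G x)"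
proof -
  have "definable_map (\<lambda>p :: real \<times> real. fst p * snd p)"
  proof -
    have "linear (\<lambda>q :: (real \<times> real) \<times> real. (fst (fst q), snd (fst q), snd q))"
      by (rule linearI) (simp_all add: prod_eq_iff)
    from definable_substitute[OF this definable_graph_times[unfolded case_prod_beta']]
    show ?thesis by (simp add: definable_map_def)
  qed
  from definable_map_compose[OF definable_map_Pair[OF assms] this] show ?thesis by simp
qed

lemma definable_map_power:
  "definable_map (F :: _ \<Rightarrow> real) \<Longrightarrow> definable_map (\<lambda>x. F x ^ k)"
  by (induction k) (auto intro: definable_map_times definable_map_const_real)

lemma definable_map_sum:
  "finite S \<Longrightarrow> (\<And>i. i \<in> S \<Longrightarrow> definable_map (F i)) \<Longrightarrow> definable_map (\<lambda>x. \<Sum>i\<in>S. F i x :: real)"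
  by (induction S rule: finite_induct) (simp_all add: definable_map_const_real definable_map_add)

lemma definable_map_component: "definable_map F \<Longrightarrow> definable_map (\<lambda>x. F x \<bullet> b)"
  by (rule definable_map_linear_compose[where L = "\<lambda>x. x \<bullet> b"])
     (auto intro!: linearI simp: inner_add_left)

lemma definable_map_inner:
  "definable_map F \<Longrightarrow> definable_map G \<Longrightarrow> definable_map (\<lambda>x. F x \<bullet> G x)"
  by (subst euclidean_inner)
     (intro definable_map_sum definable_map_times definable_map_component finite_Basis)

text \<open>
The order of the real numbers is definable because the nonnegative numbers are the squares.
\<close>

lemma definable_le:
  assumes "definable_map F" "definable_map (G :: _ \<Rightarrow> real)"
  shows "definable {x. F x \<le> G x}"
proof -
  have "definable {x. \<exists>y :: real. G x - F x = y * y}"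
    using definable_map_compose[OF definable_map_fst[OF definable_map_id] assms(1)]
      definable_map_compose[OF definable_map_fst[OF definable_map_id] assms(2)]
    by (intro definable_ex definable_eq definable_map_diff definable_map_times
        definable_map_snd definable_map_id)
  moreover have "(\<exists>y. G x - F x = y * y) \<longleftrightarrow> F x \<le> G x" for x
    by (metis diff_ge_0_iff_ge real_sqrt_mult_self zero_le_square abs_of_nonneg)
  ultimately show ?thesis by simp
qed

lemma definable_less:
  assumes "definable_map F" "definable_map (G :: _ \<Rightarrow> real)"
  shows "definable {x. F x < G x}"
  using definable_not[OF definable_le[OF assms(2,1)]] by (simp add: not_le)

lemma definable_map_norm:
  assumes "definable_map F" shows "definable_map (\<lambda>x. norm (F x))"
proof -
  have eq: "s = norm v \<longleftrightarrow> 0 \<le> s \<and> s * s = v \<bullet> v" for s and v :: 'b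
    by (metis abs_of_nonneg norm_ge_zero norm_eq_sqrt_inner power2_eq_square power2_norm_eq_inner
        real_sqrt_abs2)
  show ?thesis unfolding definable_map_def eq
    by (intro definable_conj definable_le definable_eq definable_map_times definable_map_inner
        definable_map_snd definable_map_id definable_map_const_real
        definable_map_compose[OF definable_map_fst[OF definable_map_id] assms])
qed

lemma definable_map_abs: "definable_map F \<Longrightarrow> definable_map (\<lambda>x. \<bar>F x :: real\<bar>)"
  using definable_map_norm[of F] by simp

lemmas definable_intros =
  definable_conj definable_disj definable_imp definable_not definable_ex definable_all
  definable_eq definable_le definable_less
  definable_map_id definable_map_fst definable_map_snd definable_map_Pair definable_map_const_real
  definable_map_add definable_map_diff definable_map_times definable_map_power
  definable_map_component definable_map_norm definable_map_abs

lemma definable_image: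
  assumes "definable A" "definable_map F" shows "definable (F ` A)"
proof -
  have "definable {y. \<exists>x. x \<in> A \<and> y = F x}"
    by (intro definable_intros definable_member[OF assms(1)] definable_map_compose[OF _ assms(2)])
  then show ?thesis by (simp add: image_def Bex_def)
qed

lemma definable_closure:
  assumes "definable A" shows "definable (closure A)"
proof -
  have "closure A = {x. \<forall>\<epsilon>. 0 < \<epsilon> \<longrightarrow> (\<exists>y. y \<in> A \<and> norm (y - x) < \<epsilon>)}"
    by (auto simp: closure_approachable dist_norm Bex_def)
  moreover have "definable \<dots>"
    by (intro definable_intros definable_member[OF assms])
  ultimately show ?thesis by simp
qed

lemma definable_open_interval: "definable {a<..<b :: real}"
proof -
  have "{a<..<b} = {t. a < t \<and> t < b}" by auto
  moreover have "definable \<dots>" by (intro definable_intros)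
  ultimately show ?thesis by simp
qed

section \<open>Definable sets of real numbers\<close>

lemma definable_tame:
  assumes "definable (A :: real set)"
  shows "\<exists>\<J>. finite \<J> \<and> (\<forall>J\<in>\<J>. is_interval J) \<and> A = \<Union>\<J>"
proof -
  have "{t. [t] \<in> (\<lambda>t. [t]) ` A} = A" by auto
  then show ?thesis using tame[of "(\<lambda>t. [t]) ` A"] assms by (simp add: definable_real_iff)
qed

text \<open>
One of the finitely many intervals that make up the set has two points, hence is nondegenerate.
\<close>

lemma infinite_definable_contains_interval:
  assumes "definable (A :: real set)" "infinite A"
  obtains a b where "a < b" "{a..b} \<subseteq> A"
proof -
  obtain \<J> where J: "finite \<J>" "\<forall>J\<in>\<J>. is_interval J" "A = \<Union>\<J>"
    using definable_tame[OF assms(1)] by blast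
  then obtain J where "J \<in> \<J>" "infinite J" using assms(2) by auto
  then obtain c where c: "c \<in> J" using infinite_imp_nonempty by blast
  obtain d where d: "d \<in> J" "d \<noteq> c"
    using infinite_imp_nonempty[OF infinite_remove[OF \<open>infinite J\<close>, of c]] by blast
  define a b where "a = min c d" and "b = max c d"
  have ab: "a \<in> J" "b \<in> J" "a < b"
    using c d by (auto simp: a_def b_def min_def max_def)
  have "is_interval J" using J \<open>J \<in> \<J>\<close> by blast
  then have "{a..b} \<subseteq> J" using mem_is_interval_1_I[OF _ ab(1,2)] by (auto simp del: atLeastatMost_subset_iff)
  then show ?thesis using that ab J \<open>J \<in> \<J>\<close> by blast
qed

text \<open>
This is how the countable unions over integer bounds in later arguments become harmless: it
suffices to exhaust a definable set of reals by countably many finite sets.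
\<close>

lemma countable_definable_finite:
  assumes "definable (A :: real set)" "countable A" shows "finite A"
proof (rule ccontr)
  assume "infinite A"
  then obtain a b where "a < b" "{a..b} \<subseteq> A"
    using infinite_definable_contains_interval[OF assms(1)] by blast
  then show False using assms(2) countable_subset uncountable_closed_interval by blast
qed

lemma definable_cover_of_interval:
  assumes "finite \<A>" "\<And>A. A \<in> \<A> \<Longrightarrow> definable A" "{a<..<b} \<subseteq> \<Union>\<A>" "a < (b :: real)"
  obtains A a' b' where "A \<in> \<A>" "a < a'" "a' < b'" "b' < b" "{a'..b'} \<subseteq> A"
proof -
  have "infinite (\<Union>A\<in>\<A>. A \<inter> {a<..<b})"
    using infinite_super[OF _ infinite_Ioo[OF assms(4)]] assms(3) by fastforce
  then obtain A where A: "A \<in> \<A>" "infinite (A \<inter> {a<..<b})" using assms(1) by blast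
  then obtain a' b' where *: "a' < b'" "{a'..b'} \<subseteq> A \<inter> {a<..<b}"
    using infinite_definable_contains_interval definable_Int[OF assms(2)[OF A(1)] definable_open_interval]
    by metis
  moreover have "a' \<in> {a'..b'}" "b' \<in> {a'..b'}" using *(1) by auto
  ultimately have "a' \<in> {a<..<b}" "b' \<in> {a<..<b}" by blast+
  then show ?thesis using that[OF A(1)] * by auto
qed

end

section \<open>Germs of definable sets and of real functions\<close>

text \<open>
An interval that meets every one-sided neighbourhood of a point contains one of them, because it
contains everything between two of its points; similarly at infinity.
\<close>

lemma interval_germ:
  assumes "is_interval (J :: real set)"
  shows "eventually (\<lambda>s. s \<in> J) (at_right t) \<or> eventually (\<lambda>s. s \<notin> J) (at_right t)"
    and "eventually (\<lambda>s. s \<in> J) (at_left t) \<or> eventually (\<lambda>s. s \<notin> J) (at_left t)"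
    and "eventually (\<lambda>s. s \<in> J) at_top \<or> eventually (\<lambda>s. s \<notin> J) at_top"
proof -
  have J: "s \<in> J" if "u \<in> J" "v \<in> J" "u \<le> s" "s \<le> v" for u v s
    by (rule mem_is_interval_1_I[OF assms that])
  show "eventually (\<lambda>s. s \<in> J) (at_right t) \<or> eventually (\<lambda>s. s \<notin> J) (at_right t)"
  proof (rule disjCI)
    assume "\<not> eventually (\<lambda>s. s \<notin> J) (at_right t)"
    then have *: "\<exists>s. t < s \<and> s < u \<and> s \<in> J" if "t < u" for u
      using that unfolding eventually_at_right_field by blast
    obtain v where v: "t < v" "v \<in> J" using *[of "t + 1"] by auto
    have "s \<in> J" if s: "t < s" "s < v" for s
    proof -
      obtain u where "u < s" "u \<in> J" using *[OF s(1)] by blast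
      then show ?thesis using J[of u v s] v s by simp
    qed
    then show "eventually (\<lambda>s. s \<in> J) (at_right t)"
      unfolding eventually_at_right_field using v by blast
  qed
  show "eventually (\<lambda>s. s \<in> J) (at_left t) \<or> eventually (\<lambda>s. s \<notin> J) (at_left t)"
  proof (rule disjCI)
    assume "\<not> eventually (\<lambda>s. s \<notin> J) (at_left t)"
    then have *: "\<exists>s. u < s \<and> s < t \<and> s \<in> J" if "u < t" for u
      using that unfolding eventually_at_left_field by blast
    obtain v where v: "v < t" "v \<in> J" using *[of "t - 1"] by auto
    have "s \<in> J" if s: "v < s" "s < t" for s
    proof -
      obtain u where "s < u" "u \<in> J" using *[OF s(2)] by blast
      then show ?thesis using J[of v u s] v s by simp
    qed
    then show "eventually (\<lambda>s. s \<in> J) (at_left t)"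
      unfolding eventually_at_left_field using v by blast
  qed
  show "eventually (\<lambda>s. s \<in> J) at_top \<or> eventually (\<lambda>s. s \<notin> J) at_top"
  proof (rule disjCI)
    assume "\<not> eventually (\<lambda>s. s \<notin> J) at_top"
    then have *: "\<exists>s\<ge>u. s \<in> J" for u
      unfolding eventually_at_top_linorder by blast
    obtain v where v: "v \<in> J" using * by blast
    have "s \<in> J" if "v \<le> s" for s
    proof -
      obtain u where "s \<le> u" "u \<in> J" using * by blast
      then show ?thesis using J[of v u s] v that by simp
    qed
    then show "eventually (\<lambda>s. s \<in> J) at_top"
      unfolding eventually_at_top_linorder by blast
  qed
qed

lemma finite_union_germ:
  assumes "finite \<J>" "\<And>J. J \<in> \<J> \<Longrightarrow> eventually (\<lambda>s. s \<in> J) F \<or> eventually (\<lambda>s. s \<notin> J) F"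
  shows "eventually (\<lambda>s. s \<in> \<Union>\<J>) F \<or> eventually (\<lambda>s. s \<notin> \<Union>\<J>) F"
proof (cases "\<exists>J\<in>\<J>. eventually (\<lambda>s. s \<in> J) F")
  case True
  then obtain J where "J \<in> \<J>" "eventually (\<lambda>s. s \<in> J) F" by blast
  then show ?thesis by (auto elim: eventually_mono)
next
  case False
  then have "\<forall>J\<in>\<J>. eventually (\<lambda>s. s \<notin> J) F" using assms(2) by blast
  then have "eventually (\<lambda>s. \<forall>J\<in>\<J>. s \<notin> J) F" using assms(1) by (simp add: eventually_ball_finite)
  then show ?thesis by simp
qed

text \<open>
A strict local minimum \<open>t\<close> is the only minimum of \<open>g\<close> on some rational interval around
\<open>t\<close>, so it is determined by the two rational endpoints.
\<close>

lemma countable_strict_local_minima: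
  fixes g :: "real \<Rightarrow> real"
  shows "countable {t. eventually (\<lambda>s. g t < g s) (at t)}"
proof -
  define S where "S = (\<lambda>(p, q). {t. p < t \<and> t < q \<and> (\<forall>s. p < s \<and> s < q \<and> s \<noteq> t \<longrightarrow> g t < g s)})"
  have "countable (S pq)" for pq
  proof -
    have "s = t" if "s \<in> S pq" "t \<in> S pq" for s t
    proof (rule ccontr)
      assume "s \<noteq> t"
      then have "g s < g t" "g t < g s" using that by (auto simp: S_def)
      then show False by simp
    qed
    then have "\<exists>u. S pq \<subseteq> {u}" by blast
    then show ?thesis by (meson countable_empty countable_insert countable_subset)
  qed
  moreover have "countable (\<rat> \<times> \<rat> :: (real \<times> real) set)" by (simp add: countable_rat)
  ultimately have "countable (\<Union>pq\<in>\<rat> \<times> \<rat>. S pq)" by blast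
  moreover have "{t. eventually (\<lambda>s. g t < g s) (at t)} \<subseteq> (\<Union>pq\<in>\<rat> \<times> \<rat>. S pq)"
  proof
    fix t assume "t \<in> {t. eventually (\<lambda>s. g t < g s) (at t)}"
    then obtain d where d: "d > 0" "\<And>s. s \<noteq> t \<Longrightarrow> \<bar>s - t\<bar> < d \<Longrightarrow> g t < g s"
      by (auto simp: eventually_at dist_real_def)
    obtain p where p: "p \<in> \<rat>" "t - d < p" "p < t" using Rats_dense_in_real[of "t - d" t] d by auto
    obtain q where q: "q \<in> \<rat>" "t < q" "q < t + d" using Rats_dense_in_real[of t "t + d"] d by auto
    have "t \<in> S (p, q)" using p q d by (auto simp: S_def)
    then show "t \<in> (\<Union>pq\<in>\<rat> \<times> \<rat>. S pq)" using p q by blast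
  qed
  ultimately show ?thesis by (rule countable_subset[rotated])
qed

text \<open>
On a small interval around a point the values at the ends are compared through the value at that
point; the small intervals are then chained by compactness (Bolzano's principle).
\<close>

lemma locally_increasing_imp_mono_on:
  fixes g :: "real \<Rightarrow> real"
  assumes right: "\<And>t. t \<in> {a..b} \<Longrightarrow> eventually (\<lambda>s. g t < g s) (at_right t)"
    and left: "\<And>t. t \<in> {a..b} \<Longrightarrow> eventually (\<lambda>s. g s < g t) (at_left t)"
  shows "mono_on {a..b} g"
proof (rule mono_onI)
  fix x y assume xy: "x \<in> {a..b}" "y \<in> {a..b}" "x \<le> y"
  show "g x \<le> g y"
  proof (rule Bolzano[OF xy(3)])
    fix u v w assume "g u \<le> g v" "g v \<le> g w" then show "g u \<le> g w" by simp
  next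
    fix t assume "x \<le> t" "t \<le> y"
    then have t: "t \<in> {a..b}" using xy by auto
    obtain u where u: "t < u" "\<And>s. t < s \<Longrightarrow> s < u \<Longrightarrow> g t < g s"
      using right[OF t] unfolding eventually_at_right_field by blast
    obtain v where v: "v < t" "\<And>s. v < s \<Longrightarrow> s < t \<Longrightarrow> g s < g t"
      using left[OF t] unfolding eventually_at_left_field by blast
    have "g c \<le> g d" if "c \<le> t" "t \<le> d" "d - c < min (u - t) (t - v)" for c d
    proof -
      have "g c \<le> g t" using v(2)[of c] that by (cases "c = t") auto
      also have "g t \<le> g d" using u(2)[of d] that by (cases "d = t") auto
      finally show ?thesis .
    qed
    then show "\<exists>d>0. \<forall>c e. c \<le> t \<and> t \<le> e \<and> e - c < d \<longrightarrow> g c \<le> g e"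
      using u(1) v(1) by (intro exI[of _ "min (u - t) (t - v)"]) auto
  qed
qed

section \<open>Piecewise monotonicity\<close>

context o_minimal_structure
begin

text \<open>
By tameness a definable set of reals cannot oscillate, so near a point, on either side, and near
infinity, it contains everything or nothing.
\<close>

lemma definable_germ:
  assumes "definable (A :: real set)"
  shows definable_germ_right: "eventually (\<lambda>s. s \<in> A) (at_right t) \<or> eventually (\<lambda>s. s \<notin> A) (at_right t)"
    and definable_germ_left: "eventually (\<lambda>s. s \<in> A) (at_left t) \<or> eventually (\<lambda>s. s \<notin> A) (at_left t)"
    and definable_germ_top: "eventually (\<lambda>s. s \<in> A) at_top \<or> eventually (\<lambda>s. s \<notin> A) at_top"
proof -
  obtain \<J> where J: "finite \<J>" "\<And>J. J \<in> \<J> \<Longrightarrow> is_interval J" "A = \<Union>\<J>"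
    using definable_tame[OF assms] by blast
  show "eventually (\<lambda>s. s \<in> A) (at_right t) \<or> eventually (\<lambda>s. s \<notin> A) (at_right t)"
    "eventually (\<lambda>s. s \<in> A) (at_left t) \<or> eventually (\<lambda>s. s \<notin> A) (at_left t)"
    "eventually (\<lambda>s. s \<in> A) at_top \<or> eventually (\<lambda>s. s \<notin> A) at_top"
    unfolding J(3) using finite_union_germ[OF J(1)] interval_germ[OF J(2)] by blast+
qed

lemma definable_eventually:
  fixes P :: "real \<Rightarrow> real \<Rightarrow> bool"
  assumes "definable {p. P (fst p) (snd p)}"
  shows definable_eventually_right: "definable {t. eventually (P t) (at_right t)}"
    and definable_eventually_left: "definable {t. eventually (P t) (at_left t)}"
proof -
  have P: "definable {x. P (F x) (G x)}" if "definable_map F" "definable_map G"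
    for F G :: "'b::euclidean_space \<Rightarrow> real"
    using definable_member[OF assms definable_map_Pair[OF that]] by simp
  show "definable {t. eventually (P t) (at_right t)}"
    unfolding eventually_at_right_field by (intro definable_intros P)
  show "definable {t. eventually (P t) (at_left t)}"
    unfolding eventually_at_left_field by (intro definable_intros P)
qed

text \<open>
At each \<open>t\<close> the three sets of \<open>s\<close> with \<open>g s\<close> below, equal to or above \<open>g t\<close> are
definable, so exactly one of the three relations holds just to the right of \<open>t\<close>, and one holds
just to the left. These nine types of points form definable sets covering the interval, hence one
type prevails on a whole subinterval. If equality occurs there, \<open>g\<close> is constant close to one
point; if \<open>g\<close> locally increases or decreases, it does so globally; and the two remaining types
would make every point of an interval a strict local minimum, or every point a strict local
maximum, although there are only countably many such points.
\<close>

lemma monotone_on_subinterval: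
  fixes g :: "real \<Rightarrow> real"
  assumes g: "definable_map g" and "a < b"
  obtains a' b' where "a < a'" "a' < b'" "b' < b"
    "mono_on {a'..b'} g \<or> antimono_on {a'..b'} g"
proof -
  have g': "definable_map (\<lambda>x. g (F x))" if "definable_map F" for F :: "'b::euclidean_space \<Rightarrow> real"
    by (rule definable_map_compose[OF that g])
  define rels :: "(real \<Rightarrow> real \<Rightarrow> bool) set" where "rels = {(<), (=), (>)}"
  define R where "R \<rho> = {t. eventually (\<lambda>s. \<rho> (g s) (g t)) (at_right t)}" for \<rho> :: "real \<Rightarrow> real \<Rightarrow> bool"
  define L where "L \<rho> = {t. eventually (\<lambda>s. \<rho> (g s) (g t)) (at_left t)}" for \<rho> :: "real \<Rightarrow> real \<Rightarrow> bool"
  define \<A> where "\<A> = (\<lambda>(\<rho>, \<sigma>). R \<rho> \<inter> L \<sigma>) ` (rels \<times> rels)"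
  have def2: "definable {p. \<rho> (g (snd p)) (g (fst p))}" if "\<rho> \<in> rels" for \<rho>
    using that unfolding rels_def by (auto intro!: definable_intros g')
  have def1: "definable {s. \<rho> (g s) (g t)}" if "\<rho> \<in> rels" for \<rho> t
    using that unfolding rels_def by (auto intro!: definable_intros g')
  have "definable (R \<rho>)" "definable (L \<rho>)" if "\<rho> \<in> rels" for \<rho>
    using definable_eventually[of "\<lambda>t s. \<rho> (g s) (g t)"] def2[OF that] by (simp_all add: R_def L_def)
  then have "definable A" if "A \<in> \<A>" for A
    using that unfolding \<A>_def by (auto intro!: definable_Int)
  moreover have "{a<..<b} \<subseteq> \<Union>\<A>"
  proof
    fix t
    have "\<exists>\<rho>\<in>rels. t \<in> R \<rho>"
    proof (rule ccontr)
      assume "\<not> ?thesis"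
      then have "eventually (\<lambda>s. \<not> \<rho> (g s) (g t)) (at_right t)" if "\<rho> \<in> rels" for \<rho>
        using that definable_germ_right[OF def1[OF that], of t t] by (auto simp: R_def)
      then have "\<forall>\<rho>\<in>rels. eventually (\<lambda>s. \<not> \<rho> (g s) (g t)) (at_right t)" by blast
      then have "eventually (\<lambda>s. \<forall>\<rho>\<in>rels. \<not> \<rho> (g s) (g t)) (at_right t)"
        by (rule eventually_ball_finite[rotated]) (simp add: rels_def)
      then have "eventually (\<lambda>s. False) (at_right t)"
        by (rule eventually_mono) (auto simp: rels_def)
      then show False by simp
    qed
    moreover have "\<exists>\<rho>\<in>rels. t \<in> L \<rho>"
    proof (rule ccontr)
      assume "\<not> ?thesis"
      then have "eventually (\<lambda>s. \<not> \<rho> (g s) (g t)) (at_left t)" if "\<rho> \<in> rels" for \<rho>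
        using that definable_germ_left[OF def1[OF that], of t t] by (auto simp: L_def)
      then have "\<forall>\<rho>\<in>rels. eventually (\<lambda>s. \<not> \<rho> (g s) (g t)) (at_left t)" by blast
      then have "eventually (\<lambda>s. \<forall>\<rho>\<in>rels. \<not> \<rho> (g s) (g t)) (at_left t)"
        by (rule eventually_ball_finite[rotated]) (simp add: rels_def)
      then have "eventually (\<lambda>s. False) (at_left t)"
        by (rule eventually_mono) (auto simp: rels_def)
      then show False by simp
    qed
    ultimately show "t \<in> \<Union>\<A>" unfolding \<A>_def by force
  qed
  moreover have "finite \<A>" by (simp add: \<A>_def rels_def)
  ultimately obtain A c d where A: "A \<in> \<A>" and cd: "a < c" "c < d" "d < b" "{c..d} \<subseteq> A"
    using definable_cover_of_interval[of \<A> a b] \<open>a < b\<close> by metis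
  obtain \<rho> \<sigma> where rel: "\<rho> \<in> rels" "\<sigma> \<in> rels" and "A = R \<rho> \<inter> L \<sigma>"
    using A by (auto simp: \<A>_def)
  then have right: "eventually (\<lambda>s. \<rho> (g s) (g t)) (at_right t)"
    and left: "eventually (\<lambda>s. \<sigma> (g s) (g t)) (at_left t)" if "t \<in> {c..d}" for t
    using cd(4) that by (auto simp: R_def L_def)
  have uncountable: "uncountable {c..d}" using cd by (simp add: uncountable_closed_interval)
  consider "\<rho> = (=)" | "\<sigma> = (=)" | "\<rho> = (>)" "\<sigma> = (<)" | "\<rho> = (<)" "\<sigma> = (>)"
    | "\<rho> = (>)" "\<sigma> = (>)" | "\<rho> = (<)" "\<sigma> = (<)"
    using rel by (auto simp: rels_def)
  then show ?thesis
  proof cases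
    case 1
    then obtain u where u: "c < u" "\<And>s. c < s \<Longrightarrow> s < u \<Longrightarrow> g s = g c"
      using right[of c] cd unfolding eventually_at_right_field by auto
    \<comment> \<open>The values agree with \<open>g c\<close> only strictly to the right of \<open>c\<close>, hence the inner interval.\<close>
    define e where "e = min u d"
    have "c < e" "e \<le> u" "e \<le> d" using u(1) cd by (auto simp: e_def)
    then have "mono_on {(3 * c + e) / 4..(c + e) / 2} g"
      using u(2) by (intro mono_onI) auto
    then show ?thesis
      using that[of "(3 * c + e) / 4" "(c + e) / 2"] \<open>c < e\<close> \<open>e \<le> d\<close> cd by auto
  next
    case 2
    then obtain u where u: "u < d" "\<And>s. u < s \<Longrightarrow> s < d \<Longrightarrow> g s = g d"
      using left[of d] cd unfolding eventually_at_left_field by auto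
    define e where "e = max u c"
    have "e < d" "u \<le> e" "c \<le> e" using u(1) cd by (auto simp: e_def)
    then have "mono_on {(d + e) / 2..(3 * d + e) / 4} g"
      using u(2) by (intro mono_onI) auto
    then show ?thesis
      using that[of "(d + e) / 2" "(3 * d + e) / 4"] \<open>e < d\<close> \<open>c \<le> e\<close> cd by auto
  next
    case 3
    then have "mono_on {c..d} g"
      using right left by (intro locally_increasing_imp_mono_on) auto
    then show ?thesis using that cd by blast
  next
    case 4
    then have "mono_on {c..d} (\<lambda>t. - g t)"
      using right left by (intro locally_increasing_imp_mono_on) auto
    then have "antimono_on {c..d} g" by (simp add: monotone_on_def)
    then show ?thesis using that cd by blast
  next
    case 5
    then have "{c..d} \<subseteq> {t. eventually (\<lambda>s. g t < g s) (at t)}"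
      using right left by (auto simp: eventually_at_split)
    then show ?thesis using countable_strict_local_minima uncountable countable_subset by blast
  next
    case 6
    then have "{c..d} \<subseteq> {t. eventually (\<lambda>s. - g t < - g s) (at t)}"
      using right left by (auto simp: eventually_at_split)
    then show ?thesis using countable_strict_local_minima[of "\<lambda>t. - g t"] uncountable countable_subset by blast
  qed
qed

section \<open>Finiteness from a quadratic modulus\<close>

text \<open>
The set \<open>B\<close> is thinned out until each coordinate \<open>x \<bullet> c\<close> with \<open>c \<in> C\<close> is a monotone
function \<open>g c\<close> of \<open>t\<close> for \<open>(t, x) \<in> B'\<close>. One coordinate at a time, only the points minimizing
it are kept in each fibre; compactness of the fibres makes the minimum exist, and the minimum
is a definable function of \<open>t\<close>, hence monotone after shrinking the interval. With \<open>C\<close> the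
whole basis this amounts to a definable choice of lexicographically minimal points.
\<close>

lemma monotone_selection:
  fixes B :: "(real \<times> 'a::euclidean_space) set"
  assumes "finite C" "definable B" "a < b"
    and "\<forall>t\<in>{a..b}. compact {x. (t, x) \<in> B} \<and> {x. (t, x) \<in> B} \<noteq> {}"
  shows "\<exists>B' a' b' g. B' \<subseteq> B \<and> definable B' \<and> a \<le> a' \<and> a' < b' \<and> b' \<le> b \<and>
    (\<forall>t\<in>{a'..b'}. compact {x. (t, x) \<in> B'} \<and> {x. (t, x) \<in> B'} \<noteq> {}) \<and>
    (\<forall>c\<in>C. (mono_on {a'..b'} (g c) \<or> antimono_on {a'..b'} (g c)) \<and>
       (\<forall>t\<in>{a'..b'}. \<forall>x. (t, x) \<in> B' \<longrightarrow> x \<bullet> c = (g c t :: real)))"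
  using assms(1)
proof (induction C rule: finite_induct)
  case empty
  show ?case using assms by (intro exI[of _ B] exI[of _ a] exI[of _ b]) simp
next
  case (insert c C)
  from insert.IH obtain B' a' b' g where B': "B' \<subseteq> B" "definable B'"
    and ab: "a \<le> a'" "a' < b'" "b' \<le> b"
    and fib: "\<forall>t\<in>{a'..b'}. compact {x. (t, x) \<in> B'} \<and> {x. (t, x) \<in> B'} \<noteq> {}"
    and g: "\<forall>c\<in>C. (mono_on {a'..b'} (g c) \<or> antimono_on {a'..b'} (g c)) \<and>
       (\<forall>t\<in>{a'..b'}. \<forall>x. (t, x) \<in> B' \<longrightarrow> x \<bullet> c = (g c t :: real))"
    by (elim exE conjE) (rule that)
  define B'' where "B'' = {p. p \<in> B' \<and> (\<forall>y. (fst p, y) \<in> B' \<longrightarrow> snd p \<bullet> c \<le> y \<bullet> c)}"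
  have "definable B''"
    unfolding B''_def by (intro definable_intros definable_member[OF B'(2)])
  have fib'': "compact {x. (t, x) \<in> B''} \<and> {x. (t, x) \<in> B''} \<noteq> {}" if t: "t \<in> {a'..b'}" for t
  proof -
    have "continuous_on {x. (t, x) \<in> B'} (\<lambda>x. x \<bullet> c)" by (intro continuous_intros)
    then obtain x where x: "(t, x) \<in> B'" "\<And>y. (t, y) \<in> B' \<Longrightarrow> x \<bullet> c \<le> y \<bullet> c"
      using continuous_attains_inf[of "{x. (t, x) \<in> B'}" "\<lambda>x. x \<bullet> c"] fib t by blast
    then have "{x. (t, x) \<in> B''} = {y. (t, y) \<in> B'} \<inter> {y. y \<bullet> c = x \<bullet> c}"
      by (force simp: B''_def)
    moreover have "closed {y. y \<bullet> c = x \<bullet> c}"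
      by (intro closed_Collect_eq continuous_intros)
    ultimately show ?thesis using x fib t by (auto intro: compact_Int_closed)
  qed
  \<comment> \<open>The value outside the interval is arbitrary but definable, which makes \<open>h\<close> a definable map.\<close>
  define h where "h t = (if t \<in> {a'..b'} then (SOME x. (t, x) \<in> B'') \<bullet> c else 0)" for t
  have h: "x \<bullet> c = h t" if "t \<in> {a'..b'}" "(t, x) \<in> B''" for t x
  proof -
    have "(t, SOME x. (t, x) \<in> B'') \<in> B''" using that(2) by (rule someI)
    then have "(SOME x. (t, x) \<in> B'') \<bullet> c = x \<bullet> c"
      using that(2) by (intro antisym) (auto simp: B''_def)
    then show ?thesis using that(1) by (simp add: h_def)
  qed
  have "u = h t \<longleftrightarrow> a' \<le> t \<and> t \<le> b' \<and> (\<exists>x. (t, x) \<in> B'' \<and> u = x \<bullet> c) \<or> \<not> (a' \<le> t \<and> t \<le> b') \<and> u = 0" for t u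
  proof (cases "t \<in> {a'..b'}")
    case True
    then obtain x where "(t, x) \<in> B''" using fib'' by blast
    then show ?thesis using True h by auto
  qed (auto simp: h_def)
  then have "definable_map h"
    unfolding definable_map_def
    by (auto intro!: definable_intros definable_member[OF \<open>definable B''\<close>])
  then obtain a'' b'' where ab'': "a' < a''" "a'' < b''" "b'' < b'"
    and mono: "mono_on {a''..b''} h \<or> antimono_on {a''..b''} h"
    using monotone_on_subinterval ab(2) by metis
  have sub: "{a''..b''} \<subseteq> {a'..b'}" using ab'' by auto
  define g' where "g' = g(c := h)"
  have "(mono_on {a''..b''} (g' d) \<or> antimono_on {a''..b''} (g' d)) \<and>
      (\<forall>t\<in>{a''..b''}. \<forall>x. (t, x) \<in> B'' \<longrightarrow> x \<bullet> d = g' d t)" if "d \<in> insert c C" for d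
  proof (cases "d = c")
    case True
    have "x \<bullet> c = h t" if "t \<in> {a''..b''}" "(t, x) \<in> B''" for t x
      using h sub that by blast
    then show ?thesis using mono True by (simp add: g'_def)
  next
    case False
    then have "d \<in> C" using that by simp
    then have "mono_on {a''..b''} (g d) \<or> antimono_on {a''..b''} (g d)"
      using g monotone_on_subset[OF _ sub] by blast
    moreover have "x \<bullet> d = g d t" if "t \<in> {a''..b''}" "(t, x) \<in> B''" for t x
    proof -
      have "t \<in> {a'..b'}" "(t, x) \<in> B'" using sub that by (auto simp: B''_def)
      then show ?thesis using g \<open>d \<in> C\<close> by blast
    qed
    ultimately show ?thesis using False by (simp add: g'_def)
  qed
  moreover have "\<forall>t\<in>{a''..b''}. compact {x. (t, x) \<in> B''} \<and> {x. (t, x) \<in> B''} \<noteq> {}"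
    using fib'' sub by blast
  moreover have "B'' \<subseteq> B" using B'(1) by (auto simp: B''_def)
  moreover have "a \<le> a''" "b'' \<le> b" using ab ab'' by auto
  ultimately have "B'' \<subseteq> B \<and> definable B'' \<and> a \<le> a'' \<and> a'' < b'' \<and> b'' \<le> b \<and>
    (\<forall>t\<in>{a''..b''}. compact {x. (t, x) \<in> B''} \<and> {x. (t, x) \<in> B''} \<noteq> {}) \<and>
    (\<forall>d\<in>insert c C. (mono_on {a''..b''} (g' d) \<or> antimono_on {a''..b''} (g' d)) \<and>
       (\<forall>t\<in>{a''..b''}. \<forall>x. (t, x) \<in> B'' \<longrightarrow> x \<bullet> d = g' d t))"
    using \<open>definable B''\<close> ab''(2) by (intro conjI ballI) simp_all
  then show ?case by (intro exI)
qed

end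

text \<open>
The hypothesis says that \<open>V\<close> grows at least like a square root on every subinterval. On each of
\<open>N\<close> pieces of length \<open>(b - a) / N\<close> it then grows by a multiple of \<open>1 / sqrt N\<close>, so
in total by a multiple of \<open>sqrt N\<close>, which is unbounded.
\<close>

lemma no_square_modulus:
  fixes V :: "real \<Rightarrow> real"
  assumes "a < b" "0 < K"
    and V: "\<And>s t. a \<le> s \<Longrightarrow> s \<le> t \<Longrightarrow> t \<le> b \<Longrightarrow> V s \<le> V t \<and> t - s \<le> K * (V t - V s)\<^sup>2"
  shows False
proof -
  obtain N :: nat where N: "real N > (V b - V a)\<^sup>2 * K / (b - a)" using reals_Archimedean2 by blast
  moreover have "(V b - V a)\<^sup>2 * K / (b - a) \<ge> 0" using assms by simp
  ultimately have N0: "real N > 0" by linarith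
  define h where "h = (b - a) / real N"
  define p where "p i = a + real i * h" for i :: nat
  have h: "h > 0" "real N * h = b - a" using N0 assms by (simp_all add: h_def)
  have "sqrt (h / K) \<le> V (p (Suc i)) - V (p i)" if "i < N" for i
  proof -
    have "real (Suc i) * h \<le> real N * h" using that h by (intro mult_right_mono) auto
    then have *: "a \<le> p i" "p i \<le> p (Suc i)" "p (Suc i) \<le> b"
      using h by (auto simp: p_def algebra_simps)
    have "p (Suc i) - p i = h" by (simp add: p_def algebra_simps)
    then have "h / K \<le> (V (p (Suc i)) - V (p i))\<^sup>2"
      using V[OF *] \<open>0 < K\<close> by (simp add: field_simps)
    then show ?thesis using V[OF *] by (simp add: real_le_lsqrt)
  qed
  then have "(\<Sum>i<N. sqrt (h / K)) \<le> (\<Sum>i<N. V (p (Suc i)) - V (p i))" by (intro sum_mono) auto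
  also have "\<dots> = V (p N) - V (p 0)" by (rule sum_lessThan_telescope)
  also have "\<dots> = V b - V a" using h(2) by (simp add: p_def)
  finally have "real N * sqrt (h / K) \<le> V b - V a" by simp
  then have "(real N * sqrt (h / K))\<^sup>2 \<le> (V b - V a)\<^sup>2"
    using h assms by (intro power_mono) auto
  moreover have "(real N * sqrt (h / K))\<^sup>2 = real N * (real N * h) / K"
    using h(1) \<open>0 < K\<close> by (simp add: power_mult_distrib power2_eq_square[of "real N"])
  ultimately have "real N * (real N * h) / K \<le> (V b - V a)\<^sup>2" by simp
  then show False
    using N assms unfolding h(2) by (simp add: field_simps)
qed

context o_minimal_structure
begin

text \<open>
This plays the part of Sard's theorem. If the projection were infinite, there would be an
interval of \<open>t\<close> on which points \<open>x\<close> with \<open>(t, x)\<close> in the closure of \<open>B\<close> can be chosen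
with all coordinates monotone in \<open>t\<close>. The sum \<open>V\<close> of the coordinates, with signs that make
all of them increasing, dominates the distances \<open>norm (x - y)\<close>; so the quadratic modulus
would force \<open>V\<close> to grow like a square root on every subinterval, which is impossible.
Passing to the closure preserves the inequality and makes the fibres compact.
\<close>

lemma quadratic_modulus_imp_finite:
  fixes B :: "(real \<times> 'a::euclidean_space) set"
  assumes "definable B" "bounded B"
    and modulus: "\<And>t x s y. (t, x) \<in> B \<Longrightarrow> (s, y) \<in> B \<Longrightarrow> \<bar>t - s\<bar> \<le> K * (norm (x - y))\<^sup>2"
  shows "finite (fst ` B)"
proof (rule ccontr)
  assume inf: "infinite (fst ` B)"
  obtain a b where "a < b" and ab: "{a..b} \<subseteq> fst ` B"
    by (rule infinite_definable_contains_interval[OF definable_fst_image[OF assms(1)] inf])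
  have "closed {q :: (real \<times> 'a) \<times> real \<times> 'a.
      \<bar>fst (fst q) - fst (snd q)\<bar> \<le> K * (norm (snd (fst q) - snd (snd q)))\<^sup>2}"
    by (intro closed_Collect_le continuous_intros)
  then have "closure (B \<times> B) \<subseteq> {q. \<bar>fst (fst q) - fst (snd q)\<bar> \<le> K * (norm (snd (fst q) - snd (snd q)))\<^sup>2}"
    using modulus by (intro closure_minimal) auto
  then have modulus': "\<bar>t - s\<bar> \<le> K * (norm (x - y))\<^sup>2"
    if "(t, x) \<in> closure B" "(s, y) \<in> closure B" for t s x y
    using that by (auto simp: closure_Times)
  have "\<forall>t\<in>{a..b}. compact {x. (t, x) \<in> closure B} \<and> {x. (t, x) \<in> closure B} \<noteq> {}"
  proof (intro ballI conjI)
    fix t assume t: "t \<in> {a..b}"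
    have "{x. (t, x) \<in> closure B} \<subseteq> snd ` closure B" by force
    then have "bounded {x. (t, x) \<in> closure B}"
      using assms(2) by (meson bounded_closure bounded_snd bounded_subset)
    moreover have "closed (Pair t -` closure B)"
      by (intro closed_vimage continuous_intros) simp
    ultimately show "compact {x. (t, x) \<in> closure B}"
      by (simp add: compact_eq_bounded_closed vimage_def)
    show "{x. (t, x) \<in> closure B} \<noteq> {}"
      using ab t closure_subset[of B] by force
  qed
  from monotone_selection[OF finite_Basis definable_closure[OF assms(1)] \<open>a < b\<close> this]
  obtain B' a' b' g where B': "B' \<subseteq> closure B" "a' < b'"
    and ne: "\<forall>t\<in>{a'..b'}. compact {x. (t, x) \<in> B'} \<and> {x. (t, x) \<in> B'} \<noteq> {}"
    and g: "\<forall>c\<in>Basis. (mono_on {a'..b'} (g c) \<or> antimono_on {a'..b'} (g c)) \<and>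
       (\<forall>t\<in>{a'..b'}. \<forall>x. (t, x) \<in> B' \<longrightarrow> x \<bullet> c = (g c t :: real))"
    by (elim exE conjE) (rule that)
  have mono: "mono_on {a'..b'} (g c) \<or> antimono_on {a'..b'} (g c)" if "c \<in> Basis" for c
    using g that by blast
  have coord: "x \<bullet> c = g c t" if "c \<in> Basis" "t \<in> {a'..b'}" "(t, x) \<in> B'" for c t x
    using g that by blast
  \<comment> \<open>\<open>V\<close> is the total variation of the curve in the \<open>\<ell>\<^sup>1\<close> norm, up to an additive constant.\<close>
  define \<sigma> :: "'a \<Rightarrow> real" where "\<sigma> c = (if mono_on {a'..b'} (g c) then 1 else - 1)" for c
  define V where "V t = (\<Sum>c\<in>Basis. \<sigma> c * g c t)" for t
  \<comment> \<open>The constant has to be positive for the division into pieces.\<close>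
  define K' where "K' = max K 1"
  have "V s \<le> V t \<and> t - s \<le> K' * (V t - V s)\<^sup>2" if st: "a' \<le> s" "s \<le> t" "t \<le> b'" for s t
  proof -
    obtain x y where xy: "(s, x) \<in> B'" "(t, y) \<in> B'" using ne st by fastforce
    have "\<bar>(y - x) \<bullet> c\<bar> = \<sigma> c * g c t - \<sigma> c * g c s" if "c \<in> Basis" for c
    proof (cases "mono_on {a'..b'} (g c)")
      case True
      then have "g c s \<le> g c t" using st by (simp add: monotone_on_def)
      then show ?thesis
        using coord[OF that _ xy(1)] coord[OF that _ xy(2)] st True by (simp add: \<sigma>_def inner_diff_left)
    next
      case False
      then have "g c t \<le> g c s" using st mono[OF that] by (auto simp: monotone_on_def)
      then show ?thesis
        using coord[OF that _ xy(1)] coord[OF that _ xy(2)] st False by (simp add: \<sigma>_def inner_diff_left)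
    qed
    then have "norm (y - x) \<le> V t - V s"
      using norm_le_l1[of "y - x"] by (simp add: V_def sum_subtractf)
    moreover from this have "(norm (y - x))\<^sup>2 \<le> (V t - V s)\<^sup>2" by (intro power_mono) auto
    moreover have "\<bar>t - s\<bar> \<le> K * (norm (y - x))\<^sup>2"
      by (rule modulus') (use xy B'(1) in blast)+
    moreover have "K * (norm (y - x))\<^sup>2 \<le> K' * (norm (y - x))\<^sup>2"
      by (intro mult_right_mono) (auto simp: K'_def)
    moreover have "K' * (norm (y - x))\<^sup>2 \<le> K' * (V t - V s)\<^sup>2" if "(norm (y - x))\<^sup>2 \<le> (V t - V s)\<^sup>2"
      using that by (intro mult_left_mono) (auto simp: K'_def)
    moreover have "0 \<le> norm (y - x)" by simp
    ultimately show ?thesis by linarith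
  qed
  moreover have "0 < K'" by (simp add: K'_def less_max_iff_disj)
  ultimately show False using no_square_modulus[of a' b' K' V] B'(2) by blast
qed

section \<open>Limits at infinity of a plane definable set\<close>

text \<open>
Suppose an interval consisted of limits. For each \<open>R\<close> the values taken by \<open>V\<close> beyond \<open>R\<close>
are dense in the interval and form a definable set, so they omit only finitely many \<open>c\<close>. Thus
all \<open>c\<close> outside a countable set are taken at arbitrarily large \<open>r\<close>; by tameness such a
\<open>c\<close> is taken at every large \<open>r\<close>, in particular at a natural number. But the countably many
fibres over natural numbers contain only countably many \<open>c\<close>.
\<close>

lemma finite_limits_at_infinity:
  fixes V :: "(real \<times> real) set"
  assumes V: "definable V" and fib: "\<And>r. countable {c. (r, c) \<in> V}"
  shows "finite {c. \<forall>\<epsilon> R. 0 < \<epsilon> \<longrightarrow> (\<exists>r c'. R < r \<and> (r, c') \<in> V \<and> \<bar>c' - c\<bar> < \<epsilon>)}" (is "finite ?S")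
proof (rule ccontr)
  assume inf: "infinite ?S"
  have "definable ?S" by (intro definable_intros definable_member[OF V])
  from infinite_definable_contains_interval[OF this inf]
  obtain a b where "a < b" and ab: "{a..b} \<subseteq> ?S" by blast
  define W where "W R = {c. \<exists>r. R < r \<and> (r, c) \<in> V}" for R
  have "finite ({a<..<b} - W R)" for R
  proof (rule ccontr)
    assume inf: "infinite ({a<..<b} - W R)"
    have "definable (W R)" unfolding W_def by (intro definable_intros definable_member[OF V])
    then have "definable ({a<..<b} - W R)"
      by (simp add: Diff_eq definable_Int definable_Compl definable_open_interval)
    from infinite_definable_contains_interval[OF this inf]
    obtain c d where cd: "c < d" "{c..d} \<subseteq> {a<..<b} - W R" by blast
    moreover have "(c + d) / 2 \<in> {c..d}" using cd by auto
    ultimately have "(c + d) / 2 \<in> {a<..<b}" by blast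
    then have "(c + d) / 2 \<in> {a..b}" by simp
    then have "(c + d) / 2 \<in> ?S" using ab by blast
    then have "\<exists>r c'. R < r \<and> (r, c') \<in> V \<and> \<bar>c' - (c + d) / 2\<bar> < \<epsilon>" if "0 < \<epsilon>" for \<epsilon>
      using that by blast
    from this[of "(d - c) / 2"] obtain r c' where "R < r" "(r, c') \<in> V"
      "\<bar>c' - (c + d) / 2\<bar> < (d - c) / 2"
      using \<open>c < d\<close> by auto
    then have "c' \<in> W R" "c' \<in> {c..d}" by (auto simp: W_def abs_less_iff field_simps)
    then show False using cd by blast
  qed
  then have "countable (\<Union>n. {a<..<b} - W (real n))"
    by (intro countable_UN) (auto intro: countable_finite)
  moreover have "countable (\<Union>n. {c. (real n, c) \<in> V})" using fib by blast
  moreover have "{a<..<b} \<subseteq> (\<Union>n. {a<..<b} - W (real n)) \<union> (\<Union>n. {c. (real n, c) \<in> V})"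
  proof (rule subsetI, rule UnCI)
    fix c assume c: "c \<in> {a<..<b}" "c \<notin> (\<Union>n. {c. (real n, c) \<in> V})"
    have "definable {r. (r, c) \<in> V}" by (intro definable_intros definable_member[OF V])
    moreover have "\<not> eventually (\<lambda>r. r \<in> {r. (r, c) \<in> V}) at_top"
    proof
      assume "eventually (\<lambda>r. r \<in> {r. (r, c) \<in> V}) at_top"
      then obtain R where "\<And>r. R \<le> r \<Longrightarrow> (r, c) \<in> V" by (auto simp: eventually_at_top_linorder)
      moreover obtain n where "R \<le> real n" using real_arch_simple by blast
      ultimately show False using c(2) by blast
    qed
    ultimately have "eventually (\<lambda>r. r \<notin> {r. (r, c) \<in> V}) at_top" using definable_germ_top by blast
    then obtain R where R: "\<And>r. R \<le> r \<Longrightarrow> (r, c) \<notin> V" by (auto simp: eventually_at_top_linorder)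
    obtain n where "R \<le> real n" using real_arch_simple by blast
    then have "c \<notin> W (real n)" using R by (force simp: W_def)
    then show "c \<in> (\<Union>n. {a<..<b} - W (real n))" using c(1) by blast
  qed
  ultimately have "countable {a<..<b}" by (meson countable_Un countable_subset)
  then show False using \<open>a < b\<close> uncountable_open_interval by blast
qed

end

section \<open>Quadratic behaviour at critical points\<close>

text \<open>
Since \<^const>\<open>grad\<close> is given by a definite description, the gradient vector has to be built
from the basis and shown to be unique.
\<close>

lemma has_derivative_grad:
  fixes f :: "'a::euclidean_space \<Rightarrow> real"
  assumes "f differentiable (at x)"
  shows "(f has_derivative (\<lambda>h. grad f x \<bullet> h)) (at x)"
proof -
  obtain f' where f': "(f has_derivative f') (at x)" using assms by (auto simp: differentiable_def)
  then interpret bounded_linear f' by (rule has_derivative_bounded_linear)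
  let ?g = "\<Sum>b\<in>Basis. f' b *\<^sub>R b"
  have "h \<bullet> ?g = f' h" for h
  proof -
    have "f' h = f' (\<Sum>b\<in>Basis. (h \<bullet> b) *\<^sub>R b)" by (simp add: euclidean_representation)
    also have "\<dots> = (\<Sum>b\<in>Basis. (h \<bullet> b) * f' b)" by (simp add: sum scale)
    finally show ?thesis by (simp add: inner_sum_right mult.commute)
  qed
  then have "GDERIV f x :> ?g" using f' by (simp add: gderiv_def)
  moreover have "g = ?g" if "GDERIV f x :> g" for g
  proof -
    have "(\<lambda>h. h \<bullet> g) = (\<lambda>h. h \<bullet> ?g)"
      using that \<open>GDERIV f x :> ?g\<close> unfolding gderiv_def by (rule has_derivative_unique)
    then have "(g - ?g) \<bullet> g = (g - ?g) \<bullet> ?g" by (rule fun_cong)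
    then have "(g - ?g) \<bullet> (g - ?g) = 0" by (simp only: inner_diff_right diff_self)
    then show ?thesis by simp
  qed
  ultimately have "GDERIV f x :> grad f x" unfolding grad_def by (rule theI)
  then show ?thesis by (simp add: gderiv_def inner_commute)
qed

lemma abs_linear_le:
  fixes T :: "'a::euclidean_space \<Rightarrow> real"
  assumes "linear T" "\<And>b. b \<in> Basis \<Longrightarrow> \<bar>T b\<bar> \<le> m b"
  shows "\<bar>T h\<bar> \<le> (\<Sum>b\<in>Basis. m b) * norm h"
proof -
  have "T h = T (\<Sum>b\<in>Basis. (h \<bullet> b) *\<^sub>R b)" by (simp add: euclidean_representation)
  also have "\<dots> = (\<Sum>b\<in>Basis. (h \<bullet> b) * T b)"
    using assms(1) by (simp add: linear_sum linear_scale)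
  finally have "\<bar>T h\<bar> \<le> (\<Sum>b\<in>Basis. \<bar>(h \<bullet> b) * T b\<bar>)" by (simp add: sum_abs)
  also have "\<dots> \<le> (\<Sum>b\<in>Basis. norm h * m b)"
    using assms(2) by (intro sum_mono) (simp add: abs_mult mult_mono Basis_le_norm)
  finally show ?thesis by (simp add: sum_distrib_left mult.commute)
qed

lemma C1_lipschitz_on_cball:
  fixes g :: "'a::euclidean_space \<Rightarrow> real"
  assumes g: "continuously_differentiable 1 g"
  shows "\<exists>M. \<forall>x\<in>cball 0 R. \<forall>y\<in>cball 0 R. \<bar>g x - g y\<bar> \<le> M * norm (x - y)"
proof -
  define T where "T x = frechet_derivative g (at x)" for x
  have T: "(g has_derivative T x) (at x)" for x
    using g by (simp add: T_def frechet_derivative_works)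
  have "\<exists>m. \<forall>x\<in>cball 0 R. \<bar>T x b\<bar> \<le> m" for b
  proof -
    have "continuous_on UNIV (\<lambda>x. T x b)" using g by (simp add: T_def)
    then have "compact ((\<lambda>x. T x b) ` cball 0 R)"
      by (intro compact_continuous_image compact_cball) (auto intro: continuous_on_subset)
    then show ?thesis using compact_imp_bounded by (force simp: bounded_iff)
  qed
  then obtain m where m: "\<And>b x. x \<in> cball 0 R \<Longrightarrow> \<bar>T x b\<bar> \<le> m b" by metis
  have "onorm (T x) \<le> (\<Sum>b\<in>Basis. m b)" if "x \<in> cball 0 R" for x
    using abs_linear_le[of "T x" m] m[OF that] T[of x]
    by (intro onorm_le) (auto intro: has_derivative_linear)
  then have "norm (g x - g y) \<le> (\<Sum>b\<in>Basis. m b) * norm (x - y)"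
    if "x \<in> cball 0 R" "y \<in> cball 0 R" for x y
    using that T by (intro differentiable_bound[of "cball 0 R"])
      (auto intro: has_derivative_at_withinI)
  then show ?thesis unfolding real_norm_def by blast
qed

text \<open>
The components of the gradient are Lipschitz continuous on the ball, so the function
\<open>z \<mapsto> f z - grad f x \<bullet> z\<close> has a derivative of size at most a constant times
\<open>norm (y - x)\<close> on the segment from \<open>x\<close> to \<open>y\<close>.
\<close>

lemma C2_taylor_on_cball:
  fixes f :: "'a::euclidean_space \<Rightarrow> real"
  assumes f: "continuously_differentiable (Suc 1) f"
  shows "\<exists>K. \<forall>x\<in>cball 0 R. \<forall>y\<in>cball 0 R. \<bar>f y - f x - grad f x \<bullet> (y - x)\<bar> \<le> K * (norm (y - x))\<^sup>2"
proof -
  have f': "(f has_derivative (\<lambda>h. grad f x \<bullet> h)) (at x)" for x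
    using f by (intro has_derivative_grad) simp
  then have fd: "frechet_derivative f (at x) = (\<lambda>h. grad f x \<bullet> h)" for x
    by (rule frechet_derivative_at[symmetric])
  have "continuously_differentiable 1 (\<lambda>x. grad f x \<bullet> b)" for b
    using f unfolding continuously_differentiable.simps(2)[of 1] fd by blast
  then have "\<exists>M. \<forall>x\<in>cball 0 R. \<forall>y\<in>cball 0 R. \<bar>grad f x \<bullet> b - grad f y \<bullet> b\<bar> \<le> M * norm (x - y)" for b
    by (rule C1_lipschitz_on_cball)
  then obtain M where M: "\<And>b x y. x \<in> cball 0 R \<Longrightarrow> y \<in> cball 0 R \<Longrightarrow>
      \<bar>grad f x \<bullet> b - grad f y \<bullet> b\<bar> \<le> M b * norm (x - y)" by metis
  define K where "K = (\<Sum>b\<in>Basis. \<bar>M b\<bar>)"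
  have "\<bar>f y - f x - grad f x \<bullet> (y - x)\<bar> \<le> K * (norm (y - x))\<^sup>2"
    if xy: "x \<in> cball 0 R" "y \<in> cball 0 R" for x y
  proof -
    have "onorm (\<lambda>h. grad f z \<bullet> h - grad f x \<bullet> h) \<le> K * norm (y - x)" if z: "z \<in> closed_segment x y" for z
    proof (rule onorm_le)
      fix h
      have "z \<in> cball 0 R" using z closed_segment_subset[OF xy convex_cball] by blast
      then have "\<bar>grad f z \<bullet> b - grad f x \<bullet> b\<bar> \<le> \<bar>M b\<bar> * norm (y - x)" for b
      proof -
        have "\<bar>grad f z \<bullet> b - grad f x \<bullet> b\<bar> \<le> M b * norm (z - x)"
          using M \<open>z \<in> cball 0 R\<close> xy(1) .
        also have "\<dots> \<le> \<bar>M b\<bar> * norm (y - x)"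
          using segment_bound(1)[OF z] by (intro mult_mono) auto
        finally show ?thesis .
      qed
      then have "\<bar>grad f z \<bullet> h - grad f x \<bullet> h\<bar> \<le> (\<Sum>b\<in>Basis. \<bar>M b\<bar> * norm (y - x)) * norm h"
        by (intro abs_linear_le linearI) (auto simp: algebra_simps inner_right_distrib)
      then show "norm (grad f z \<bullet> h - grad f x \<bullet> h) \<le> K * norm (y - x) * norm h"
        by (simp add: K_def sum_distrib_right)
    qed
    moreover have "((\<lambda>z. f z - grad f x \<bullet> z) has_derivative (\<lambda>h. grad f z \<bullet> h - grad f x \<bullet> h))
        (at z within closed_segment x y)" for z
      by (intro has_derivative_diff has_derivative_at_withinI[OF f'] has_derivative_inner_right
          has_derivative_ident)
    ultimately have "norm ((f y - grad f x \<bullet> y) - (f x - grad f x \<bullet> x)) \<le> K * norm (y - x) * norm (y - x)"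
      by (intro differentiable_bound[of "closed_segment x y"]) auto
    then show ?thesis by (simp add: algebra_simps power2_eq_square inner_diff_right)
  qed
  then show ?thesis by blast
qed

text \<open>
These sets replace sets of critical points. For \<open>\<rho> = (\<le>)\<close> the point \<open>x\<close> is compared with
the ball bounded by the sphere through \<open>x\<close>, for \<open>\<rho> = (=)\<close> with that sphere only. In
contrast to the vanishing of a gradient, the condition involves no limits, and its definability
can be read off. If it holds at two points whose norms are related by \<open>\<rho>\<close> in either direction,
it yields the inequality for this pair.
\<close>

definition quadratic_points :: "(real \<Rightarrow> real \<Rightarrow> bool) \<Rightarrow> ('a::euclidean_space \<Rightarrow> real) \<Rightarrow> real \<Rightarrow> 'a set" where
  "quadratic_points \<rho> f K = {x. \<forall>y. \<rho> (norm y) (norm x) \<longrightarrow> \<bar>f y - f x\<bar> \<le> K * (norm (y - x))\<^sup>2}"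

lemma quadratic_points_mono: "K \<le> K' \<Longrightarrow> quadratic_points \<rho> f K \<subseteq> quadratic_points \<rho> f K'"
  unfolding quadratic_points_def by (auto intro: order_trans[OF _ mult_right_mono])

lemma critical_point_is_quadratic:
  fixes f :: "'a::euclidean_space \<Rightarrow> real"
  assumes "continuously_differentiable (Suc 1) f" "grad f x = 0"
  shows "\<exists>K. x \<in> quadratic_points (\<le>) f K"
proof -
  obtain K where "\<forall>x'\<in>cball 0 (norm x). \<forall>y\<in>cball 0 (norm x).
      \<bar>f y - f x' - grad f x' \<bullet> (y - x')\<bar> \<le> K * (norm (y - x'))\<^sup>2"
    using C2_taylor_on_cball[OF assms(1)] by blast
  then have "\<bar>f y - f x - grad f x \<bullet> (y - x)\<bar> \<le> K * (norm (y - x))\<^sup>2" if "norm y \<le> norm x" for y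
    using that by simp
  then have "x \<in> quadratic_points (\<le>) f K"
    using assms(2) by (simp add: quadratic_points_def)
  then show ?thesis by blast
qed

text \<open>
On the sphere through \<open>x\<close> the linear term \<open>l * (x \<bullet> (y - x))\<close> is itself quadratic, because
\<open>x \<bullet> (y - x) = - (norm (y - x))\<^sup>2 / 2\<close> when \<open>x\<close> and \<open>y\<close> have the same norm.
\<close>

lemma M_set_is_quadratic:
  fixes f :: "'a::euclidean_space \<Rightarrow> real"
  assumes "continuously_differentiable (Suc 1) f" "x \<in> M_set f"
  shows "\<exists>K. x \<in> quadratic_points (=) f K"
proof -
  obtain K where K: "\<forall>x'\<in>cball 0 (norm x). \<forall>y\<in>cball 0 (norm x).
      \<bar>f y - f x' - grad f x' \<bullet> (y - x')\<bar> \<le> K * (norm (y - x'))\<^sup>2"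
    using C2_taylor_on_cball[OF assms(1)] by blast
  obtain l where l: "grad f x = l *\<^sub>R x" using assms(2) by (auto simp: M_set_def)
  have "\<bar>f y - f x\<bar> \<le> (K + \<bar>l\<bar> / 2) * (norm (y - x))\<^sup>2" if "norm y = norm x" for y
  proof -
    have "\<bar>f y - f x - grad f x \<bullet> (y - x)\<bar> \<le> K * (norm (y - x))\<^sup>2"
      using K that by simp
    moreover have "x \<bullet> (y - x) = - (norm (y - x))\<^sup>2 / 2"
    proof -
      have "y \<bullet> y = x \<bullet> x" using that by (simp add: norm_eq)
      then show ?thesis by (simp add: power2_norm_eq_inner algebra_simps inner_commute)
    qed
    then have "\<bar>grad f x \<bullet> (y - x)\<bar> = \<bar>l\<bar> / 2 * (norm (y - x))\<^sup>2"
      by (simp add: l abs_mult)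
    ultimately show ?thesis unfolding distrib_right by linarith
  qed
  then show ?thesis unfolding quadratic_points_def by blast
qed

section \<open>Finiteness of critical values and of limit values\<close>

context o_minimal_structure
begin

lemma definable_map_of_definable_fun:
  fixes f :: "real ^ 'n::finite \<Rightarrow> real"
  assumes e: "bij_betw e {..<CARD('n)} UNIV" and "definable_fun D e f"
  shows "definable_map f"
proof -
  let ?l = "map (\<lambda>i. (axis (e i) 1, 0)) [0..<CARD('n)] @ [(0, 1)] :: ((real ^ 'n) \<times> real) list"
  have "inj_on e {..<CARD('n)}" "range (\<lambda>i. axis i 1) = (\<lambda>i. axis (e i) (1 :: real)) ` {..<CARD('n)}"
    using e by (auto simp: bij_betw_def image_image[symmetric, of "\<lambda>i. axis i 1" e])
  then have "basis_list ?l"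
    by (auto simp: basis_list_def distinct_map inj_on_def axis_eq_axis Basis_prod_def Basis_vec_def
        atLeast0LessThan image_iff)
  moreover have "coordinates ?l ` {p. snd p = f (fst p)} = range (\<lambda>x. coords e x @ [f x])"
    by (force simp: coordinates_def coords_def inner_axis image_iff)
  ultimately show ?thesis
    using assms(2) by (simp add: definable_map_def definable_iff_coordinates definable_fun_def)
qed

text \<open>
For two points of \<open>A\<close> the relation \<open>\<rho>\<close> holds in at least one direction, so the inequality of
\<open>quadratic_points\<close> holds for all pairs in \<open>A\<close>.
\<close>

lemma finite_image_of_quadratic_points:
  fixes f :: "'a::euclidean_space \<Rightarrow> real"
  assumes f: "definable_map f" "continuous_on UNIV f"
    and A: "definable A" "bounded A" "A \<subseteq> quadratic_points \<rho> f K"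
    and \<rho>: "\<And>x y. x \<in> A \<Longrightarrow> y \<in> A \<Longrightarrow> \<rho> (norm x) (norm y) \<or> \<rho> (norm y) (norm x)"
  shows "finite (f ` A)"
proof -
  let ?B = "(\<lambda>x. (f x, x)) ` A"
  have "definable ?B"
    by (intro definable_image A(1) definable_map_Pair f(1) definable_map_id)
  moreover have "bounded ?B"
  proof -
    have "bounded (f ` closure A)"
      using A(2) f(2) by (intro compact_imp_bounded compact_continuous_image)
        (auto intro: continuous_on_subset)
    then have "bounded (f ` A)" by (rule bounded_subset) (simp add: closure_subset image_mono)
    then have "bounded (f ` A \<times> A)" using A(2) by (rule bounded_Times)
    then show ?thesis by (rule bounded_subset) auto
  qed
  moreover have "\<bar>t - s\<bar> \<le> K * (norm (x - y))\<^sup>2" if "(t, x) \<in> ?B" "(s, y) \<in> ?B" for t x s y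
  proof -
    have *: "t = f x" "s = f y" "x \<in> A" "y \<in> A" using that by auto
    then have "\<bar>f x - f y\<bar> \<le> K * (norm (x - y))\<^sup>2 \<or> \<bar>f y - f x\<bar> \<le> K * (norm (y - x))\<^sup>2"
      using A(3) \<rho>[of x y] by (auto simp: quadratic_points_def)
    then show ?thesis using * by (simp add: norm_minus_commute abs_minus_commute)
  qed
  ultimately have "finite (fst ` ?B)" by (rule quadratic_modulus_imp_finite)
  then show ?thesis by (simp add: image_image)
qed

text \<open>
Bounding the constant and the norm by natural numbers exhausts the set by countably many pieces,
each with finitely many values. The whole set of values is definable and therefore finite too.
\<close>

lemma finite_values_of_quadratic_points:
  fixes f :: "'a::euclidean_space \<Rightarrow> real"
  assumes f: "definable_map f" "continuous_on UNIV f"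
  shows "finite (f ` (\<Union>K. quadratic_points (\<le>) f K))" (is "finite (f ` ?C)")
proof (rule countable_definable_finite)
  have f': "definable_map (\<lambda>x. f (F x))" if "definable_map F" for F :: "'b::euclidean_space \<Rightarrow> 'a"
    by (rule definable_map_compose[OF that f(1)])
  have "definable {x. \<exists>K. \<forall>y. norm y \<le> norm x \<longrightarrow> \<bar>f y - f x\<bar> \<le> K * (norm (y - x))\<^sup>2}"
    by (intro definable_intros f')
  moreover have "?C = {x. \<exists>K. \<forall>y. norm y \<le> norm x \<longrightarrow> \<bar>f y - f x\<bar> \<le> K * (norm (y - x))\<^sup>2}"
    by (auto simp: quadratic_points_def)
  ultimately show "definable (f ` ?C)" using definable_image[OF _ f(1)] by simp
  have "finite (f ` (quadratic_points (\<le>) f K \<inter> {x. norm x \<le> R}))" for K R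
  proof (rule finite_image_of_quadratic_points[OF f, where \<rho> = "(\<le>)"])
    show "definable (quadratic_points (\<le>) f K \<inter> {x. norm x \<le> R})"
      unfolding quadratic_points_def by (intro definable_Int definable_intros f')
    show "bounded (quadratic_points (\<le>) f K \<inter> {x. norm x \<le> R})"
      by (auto simp: bounded_iff)
  qed auto
  then have "countable (\<Union>k. \<Union>n. f ` (quadratic_points (\<le>) f (real k) \<inter> {x. norm x \<le> real n}))"
    by (intro countable_UN) (auto intro: countable_finite)
  moreover have "f ` ?C \<subseteq> (\<Union>k. \<Union>n. f ` (quadratic_points (\<le>) f (real k) \<inter> {x. norm x \<le> real n}))"
  proof
    fix v assume "v \<in> f ` ?C"
    then obtain x K where x: "v = f x" "x \<in> quadratic_points (\<le>) f K" by blast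
    obtain k n where "K \<le> real k" "norm x \<le> real n" using real_arch_simple by metis
    then show "v \<in> (\<Union>k. \<Union>n. f ` (quadratic_points (\<le>) f (real k) \<inter> {x. norm x \<le> real n}))"
      using x quadratic_points_mono[of K "real k" "(\<le>)" f] by blast
  qed
  ultimately show "countable (f ` ?C)" by (rule countable_subset[rotated])
qed

text \<open>
On a sphere of fixed radius \<open>f\<close> takes only countably many values at quadratic points: finitely
many for each natural bound on the constant. The limits in question are limits at infinity of the
plane set of all pairs of a radius and such a value.
\<close>

lemma finite_limit_values_of_quadratic_points:
  fixes f :: "'a::euclidean_space \<Rightarrow> real"
  assumes f: "definable_map f" "continuous_on UNIV f"
  shows "finite {c. \<exists>y :: nat \<Rightarrow> 'a. (\<forall>k. y k \<in> (\<Union>K. quadratic_points (=) f K)) \<and>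
     filterlim (\<lambda>k. norm (y k)) at_top sequentially \<and> (\<lambda>k. f (y k)) \<longlonglongrightarrow> c}" (is "finite ?S")
proof -
  have f': "definable_map (\<lambda>x. f (F x))" if "definable_map F" for F :: "'b::euclidean_space \<Rightarrow> 'a"
    by (rule definable_map_compose[OF that f(1)])
  let ?C = "\<Union>K. quadratic_points (=) f K"
  define V where "V = (\<lambda>x. (norm x, f x)) ` ?C"
  have "definable {x. \<exists>K. \<forall>y. norm y = norm x \<longrightarrow> \<bar>f y - f x\<bar> \<le> K * (norm (y - x))\<^sup>2}"
    by (intro definable_intros f')
  moreover have "?C = {x. \<exists>K. \<forall>y. norm y = norm x \<longrightarrow> \<bar>f y - f x\<bar> \<le> K * (norm (y - x))\<^sup>2}"
    by (auto simp: quadratic_points_def)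
  ultimately have "definable ?C" by simp
  then have "definable V"
    unfolding V_def by (intro definable_image definable_intros f(1))
  moreover have "countable {c. (r, c) \<in> V}" for r
  proof -
    have "finite (f ` (quadratic_points (=) f K \<inter> {x. norm x = r}))" for K
    proof (rule finite_image_of_quadratic_points[OF f, where \<rho> = "(=)"])
      show "definable (quadratic_points (=) f K \<inter> {x. norm x = r})"
        unfolding quadratic_points_def by (intro definable_Int definable_intros f')
      show "bounded (quadratic_points (=) f K \<inter> {x. norm x = r})"
        by (auto simp: bounded_iff)
    qed auto
    then have "countable (\<Union>k. f ` (quadratic_points (=) f (real k) \<inter> {x. norm x = r}))"
      by (intro countable_UN) (auto intro: countable_finite)
    moreover have "{c. (r, c) \<in> V} \<subseteq> (\<Union>k. f ` (quadratic_points (=) f (real k) \<inter> {x. norm x = r}))"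
    proof
      fix v assume "v \<in> {c. (r, c) \<in> V}"
      then obtain x K where x: "v = f x" "norm x = r" "x \<in> quadratic_points (=) f K"
        by (auto simp: V_def)
      obtain k where "K \<le> real k" using real_arch_simple by metis
      then show "v \<in> (\<Union>k. f ` (quadratic_points (=) f (real k) \<inter> {x. norm x = r}))"
        using x quadratic_points_mono[of K "real k" "(=)" f] by blast
    qed
    ultimately show ?thesis by (rule countable_subset[rotated])
  qed
  ultimately have "finite {c. \<forall>\<epsilon> R. 0 < \<epsilon> \<longrightarrow> (\<exists>r c'. R < r \<and> (r, c') \<in> V \<and> \<bar>c' - c\<bar> < \<epsilon>)}"
    by (rule finite_limits_at_infinity)
  moreover have "?S \<subseteq> {c. \<forall>\<epsilon> R. 0 < \<epsilon> \<longrightarrow> (\<exists>r c'. R < r \<and> (r, c') \<in> V \<and> \<bar>c' - c\<bar> < \<epsilon>)}"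
  proof (intro subsetI CollectI allI impI)
    fix c \<epsilon> R :: real assume "c \<in> ?S" "0 < \<epsilon>"
    then obtain y where y: "\<forall>k. y k \<in> ?C" "filterlim (\<lambda>k. norm (y k)) at_top sequentially"
      "(\<lambda>k. f (y k)) \<longlonglongrightarrow> c" by blast
    have "eventually (\<lambda>k. R < norm (y k)) sequentially"
      using y(2) by (simp add: filterlim_at_top_dense)
    moreover have "eventually (\<lambda>k. dist (f (y k)) c < \<epsilon>) sequentially"
      using y(3) \<open>0 < \<epsilon>\<close> by (rule tendstoD)
    ultimately have "eventually (\<lambda>k. R < norm (y k) \<and> dist (f (y k)) c < \<epsilon>) sequentially"
      by (rule eventually_conj)
    then obtain k where "R < norm (y k)" "\<bar>f (y k) - c\<bar> < \<epsilon>"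
      using eventually_happens'[OF sequentially_bot] by (metis (no_types, lifting) dist_real_def)
    moreover have "(norm (y k), f (y k)) \<in> V" using y(1) unfolding V_def by blast
    ultimately show "\<exists>r c'. R < r \<and> (r, c') \<in> V \<and> \<bar>c' - c\<bar> < \<epsilon>" by blast
  qed
  ultimately show ?thesis by (rule finite_subset[rotated])
qed

end

theorem theorem1p5:
  fixes D :: "nat \<Rightarrow> real list set set"
    and e :: "nat \<Rightarrow> 'n::finite"
    and f :: "real ^ 'n \<Rightarrow> real"
  assumes "o_minimal_structure D"
    and "bij_betw e {..<CARD('n)} UNIV"
    and "smooth f"
    and "definable_fun D e f"
  shows "finite (critical_values f) \<and> finite (S_set f)"
proof
  interpret o_minimal_structure D by fact
  have f: "definable_map f" using assms(2,4) by (rule definable_map_of_definable_fun)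
  have C2: "continuously_differentiable (Suc 1) f" using assms(3) unfolding smooth_def by blast
  have "continuously_differentiable 0 f" using assms(3) unfolding smooth_def by blast
  then have cont: "continuous_on UNIV f" by simp
  have "critical_values f \<subseteq> f ` (\<Union>K. quadratic_points (\<le>) f K)"
    using critical_point_is_quadratic[OF C2] unfolding critical_values_def by blast
  then show "finite (critical_values f)"
    using finite_values_of_quadratic_points[OF f cont] by (rule finite_subset)
  have "M_set f \<subseteq> (\<Union>K. quadratic_points (=) f K)"
    using M_set_is_quadratic[OF C2] by blast
  then have "S_set f \<subseteq> {c. \<exists>y :: nat \<Rightarrow> real ^ 'n. (\<forall>k. y k \<in> (\<Union>K. quadratic_points (=) f K)) \<and>
     filterlim (\<lambda>k. norm (y k)) at_top sequentially \<and> (\<lambda>k. f (y k)) \<longlonglongrightarrow> c}"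
    unfolding S_set_def by blast
  then show "finite (S_set f)"
    using finite_limit_values_of_quadratic_points[OF f cont] by (rule finite_subset)
qed

end
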